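(* Let $\mathbb{K}$ be an algebraically closed field of characteristic zero and let $R$ be the $\mathbb{K}$-algebra with generators $x_1,x_2,x_3,x_4$ and relations $x_1x_2+x_2x_1$, $x_1x_3+x_4x_2$, $x_1x_4-x_3x_2$, $x_2x_3-x_4x_1$, $x_2x_4+x_3x_1$, $x_3x_4+x_4x_3$. The irreducible components of the point scheme $\mathcal{P}(R)\subset\mathbb{P}^3$ are the six lines $$E_{1,2}=\mathcal{V}(x_1,x_2),\quad E_{3,4}=\mathcal{V}(x_3,x_4),\quad E_{1,3}=\mathcal{V}(x_1-x_2,x_3-x_4),$$ $$E_{2,4}=\mathcal{V}(x_1+x_2,x_3+x_4),\quad E_{2,3}=\mathcal{V}(x_1+x_2,x_3-x_4),\quad E_{1,4}=\mathcal{V}(x_1-x_2,x_3+x_4),$$ i.e. the pairwise intersections $E_{i,j}=H_i\cap H_j$ of the hyperplanes $H_1=\mathcal{V}(x_1-x_2)$, $H_2=\mathcal{V}(x_1+x_2)$, $H_3=\mathcal{V}(x_3-x_4)$, $H_4=\mathcal{V}(x_3+x_4)$. The automorphism $\tau:\mathcal{P}(R)\to\mathcal{P}(R)$ is given by: $$\begin{aligned} &E_{1,2}\to E_{1,2}:\ \tau([0:0:a:b])=[0:0:a:-b],\\ &E_{3,4}\to E_{3,4}:\ \tau([a:b:0:0])=[a:-b:0:0],\\ &E_{1,3}\to E_{2,4}:\ \tau([a:a:b:b])=[a:-a:b:-b],\\ &E_{2,4}\to E_{1,3}:\ \tau([a:-a:b:-b])=[a:a:b:b],\\ &E_{2,3}\to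 E_{1,4}:\ \tau([a:-a:b:b])=[a:a:-b:b],\\ &E_{1,4}\to E_{2,3}:\ \tau([a:a:b:-b])=[a:-a:-b:-b]. \end{aligned}$$ The scheme $\mathcal{P}(R)$ is equidimensional of dimension one and is a reduced scheme.
   Context: Let $A$ be a quadratic algebra with generators $x_1,\dots,x_4$ spanning $V=A_1$ and six quadratic relations. Identify $\mathbb{P}(V^* )$ with $\mathbb{P}^3$ via the basis dual to $x_1,\dots,x_4$. Write the relations as $M\mathbf{x}=\mathbf{0}$, where $M$ is a $6\times4$ matrix with entries in $V$ and $\mathbf{x}=(x_1,x_2,x_3,x_4)^T$. The point scheme $\mathcal{P}(A)$ is the closed subscheme of $\mathbb{P}^3$ defined by the fifteen $4\times4$ minors of $M$, viewed as polynomials in $\mathbb{K}[x_1,\dots,x_4]$. For the algebra in question, the scheme $\Gamma\subset\mathbb{P}^3\times\mathbb{P}^3$ of zeros of the multilinearized relations is the graph of an automorphism $\tau$ of $\mathcal{P}(A)$: for a closed point $p\in\mathcal{P}(A)$, the matrix $M(p)$ has rank three and $\tau(p)$ is the point of $\mathbb{P}^3$ given by the kernel of $M(p)$. Closed points of $\mathcal{P}(A)$ are in bijection with isomorphism classes of point modules (cyclic graded right modules generated in degree 0 with Hilbert series $(1-t)^{-1}$). $\mathcal{V}(\cdot)$ denotes the zero locus. *)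

theory Defs
  imports
    "HOL-Analysis.Analysis"
    "HOL-Algebra.Algebraic_Closure_Type"
    "HOL-Library.Poly_Mapping"
begin

unbundle no fps_syntax

section \<open>Free algebra on four generators\<close>

text \<open>
  Words in four letters, written additively so that finitely supported functions on words
  form, with the convolution product of \<^theory>\<open>HOL-Library.Poly_Mapping\<close>, the free
  associative algebra on the letters. The numeral type 4 has the elements 1, 2, 3 and 4 (= 0).
\<close>

datatype ncword = Word (letters: "4 list")

instantiation ncword :: monoid_add
begin

definition zero_ncword :: ncword where "zero_ncword = Word []"

definition plus_ncword :: "ncword \<Rightarrow> ncword \<Rightarrow> ncword"
  where "plus_ncword u v = Word (letters u @ letters v)"

instance
  by standard (simp_all add: zero_ncword_def plus_ncword_def)

end

type_synonym 'k free_algebra = "ncword \<Rightarrow>\<^sub>0 'k"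

definition gen :: "4 \<Rightarrow> 'k::field free_algebra"
  where "gen i = Poly_Mapping.single (Word [i]) 1"

definition relations_R :: "'k::field free_algebra ^ 6"
  where "relations_R = vector
    [gen 1 * gen 2 + gen 2 * gen 1,
     gen 1 * gen 3 + gen 4 * gen 2,
     gen 1 * gen 4 - gen 3 * gen 2,
     gen 2 * gen 3 - gen 4 * gen 1,
     gen 2 * gen 4 + gen 3 * gen 1,
     gen 3 * gen 4 + gen 4 * gen 3]"


section \<open>The homogeneous coordinate ring of projective 3-space\<close>

type_synonym 'k coord_ring = "(4 \<Rightarrow>\<^sub>0 nat) \<Rightarrow>\<^sub>0 'k"

abbreviation coord_ring :: "'k::field coord_ring ring"
  where "coord_ring \<equiv> ring_of_type_algebra"

definition Xv :: "4 \<Rightarrow> 'k::field coord_ring"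
  where "Xv i = Poly_Mapping.single (Poly_Mapping.single i 1) 1"

definition mdegree :: "(4 \<Rightarrow>\<^sub>0 nat) \<Rightarrow> nat"
  where "mdegree m = (\<Sum>i\<in>UNIV. Poly_Mapping.lookup m i)"

definition hcomp :: "nat \<Rightarrow> 'k::field coord_ring \<Rightarrow> 'k coord_ring"
  where "hcomp d f =
    (\<Sum>m | m \<in> Poly_Mapping.keys f \<and> mdegree m = d.
       Poly_Mapping.single m (Poly_Mapping.lookup f m))"

definition homogeneous :: "nat \<Rightarrow> 'k::field coord_ring \<Rightarrow> bool"
  where "homogeneous d f \<longleftrightarrow> (\<forall>m\<in>Poly_Mapping.keys f. mdegree m = d)"

definition poly_at :: "'k::field coord_ring \<Rightarrow> 'k ^ 4 \<Rightarrow> 'k"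
  where "poly_at f v =
    (\<Sum>m\<in>Poly_Mapping.keys f.
       Poly_Mapping.lookup f m * (\<Prod>i\<in>UNIV. (v $ i) ^ Poly_Mapping.lookup m i))"

definition poly_subst :: "'k::field coord_ring \<Rightarrow> 'k coord_ring ^ 4 \<Rightarrow> 'k coord_ring"
  where "poly_subst f g =
    (\<Sum>m\<in>Poly_Mapping.keys f.
       Poly_Mapping.single 0 (Poly_Mapping.lookup f m) *
       (\<Prod>i\<in>UNIV. (g $ i) ^ Poly_Mapping.lookup m i))"

definition irrelevant_ideal :: "'k::field coord_ring set"
  where "irrelevant_ideal = {f. Poly_Mapping.lookup f 0 = 0}"


section \<open>Closed subschemes of projective 3-space\<close>

text \<open>
  The underlying set of projective 3-space as a scheme: homogeneous primes not containing the
  irrelevant ideal. The closed subscheme cut out by a homogeneous ideal \<open>I\<close> has underlying set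
  \<open>zeros I\<close>; the scheme itself is represented by \<open>I\<close>, and its local rings are described
  through \<open>I\<close> below.
\<close>

definition Proj :: "'k::field coord_ring set set"
  where "Proj = {P. primeideal P coord_ring \<and> (\<forall>f\<in>P. \<forall>d. hcomp d f \<in> P)
                  \<and> \<not> irrelevant_ideal \<subseteq> P}"

definition zeros :: "'k::field coord_ring set \<Rightarrow> 'k coord_ring set set"
  where "zeros B = {P \<in> Proj. B \<subseteq> P}"

definition zariski :: "'k::field coord_ring set topology"
  where "zariski = topology (\<lambda>U. \<exists>B. U = Proj - zeros B)"

lemma istopology_zariski:
  "istopology (\<lambda>U. \<exists>B. U = (Proj :: 'k::field coord_ring set set) - zeros B)"
  unfolding istopology_def
proof (intro conjI allI impI)
  fix S T :: "'k coord_ring set set"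
  assume "\<exists>B. S = Proj - zeros B" "\<exists>B. T = Proj - zeros B"
  then obtain B C where S: "S = Proj - zeros B" and T: "T = Proj - zeros C" by blast
  have "P \<in> S \<inter> T \<longleftrightarrow> P \<in> Proj - zeros {b * c | b c. b \<in> B \<and> c \<in> C}" for P
  proof (cases "P \<in> Proj")
    case True
    then have pr: "primeideal P coord_ring" by (simp add: Proj_def)
    have idl: "ideal P coord_ring" using pr by (rule primeideal.axioms)
    have prime: "a * b \<in> P \<Longrightarrow> a \<in> P \<or> b \<in> P" for a b
      using primeideal.I_prime[OF pr, of a b] by (simp add: ring_of_type_algebra_def)
    have l: "a \<in> P \<Longrightarrow> x * a \<in> P" and r: "a \<in> P \<Longrightarrow> a * x \<in> P" for a x
      using ideal.I_l_closed[OF idl, of a x] ideal.I_r_closed[OF idl, of a x]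
      by (simp_all add: ring_of_type_algebra_def)
    have "{b * c | b c. b \<in> B \<and> c \<in> C} \<subseteq> P \<longleftrightarrow> B \<subseteq> P \<or> C \<subseteq> P"
      using prime l r by blast
    then show ?thesis using True by (auto simp: S T zeros_def)
  qed (auto simp: S T)
  then show "\<exists>B. S \<inter> T = Proj - zeros B" by blast
next
  fix K :: "'k coord_ring set set set"
  assume "\<forall>U\<in>K. \<exists>B. U = Proj - zeros B"
  then obtain B where B: "\<And>U. U \<in> K \<Longrightarrow> U = Proj - zeros (B U)" by metis
  have "\<Union>K = (\<Union>U\<in>K. Proj - zeros (B U))" using B by auto
  also have "\<dots> = Proj - zeros (\<Union>U\<in>K. B U)" by (auto simp: zeros_def)
  finally show "\<exists>B. \<Union>K = Proj - zeros B" by blast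
qed

definition scheme_space :: "'k::field coord_ring set \<Rightarrow> 'k coord_ring set topology"
  where "scheme_space I = subtopology zariski (zeros I)"

definition irreducible_in :: "'a topology \<Rightarrow> 'a set \<Rightarrow> bool"
  where "irreducible_in T Z \<longleftrightarrow> Z \<subseteq> topspace T \<and> Z \<noteq> {} \<and>
    (\<forall>C D. closedin T C \<longrightarrow> closedin T D \<longrightarrow> Z \<subseteq> C \<union> D \<longrightarrow> Z \<subseteq> C \<or> Z \<subseteq> D)"

definition irreducible_components :: "'a topology \<Rightarrow> 'a set set"
  where "irreducible_components T =
    {Z. irreducible_in T Z \<and> (\<forall>W. irreducible_in T W \<longrightarrow> Z \<subseteq> W \<longrightarrow> W = Z)}"

text \<open>Only used for nonempty spaces (the empty space would get dimension 0).\<close>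

definition krull_dim :: "'a topology \<Rightarrow> enat"
  where "krull_dim T = (SUP n \<in> {n. \<exists>Z :: nat \<Rightarrow> 'a set.
      (\<forall>i\<le>n. closedin T (Z i) \<and> irreducible_in T (Z i)) \<and> (\<forall>i<n. Z i \<subset> Z (Suc i))}. enat n)"

definition equidimensional :: "'a topology \<Rightarrow> enat \<Rightarrow> bool"
  where "equidimensional T d \<longleftrightarrow>
    (\<forall>Z\<in>irreducible_components T. krull_dim (subtopology T Z) = d)"

text \<open>
  For a point \<open>P\<close> of the subscheme defined by \<open>I\<close>, the local ring at \<open>P\<close> consists of the
  fractions \<open>f/g\<close> with \<open>f\<close>, \<open>g\<close> homogeneous of the same degree and \<open>g \<notin> P\<close>, and
  \<open>f/g = 0\<close> iff some \<open>s \<notin> P\<close> satisfies \<open>s f \<in> I\<close>. (As \<open>I\<close> and \<open>P\<close> are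
  homogeneous, \<open>s\<close> may be replaced by one of its homogeneous components.) More generally, for
  \<open>f\<close> homogeneous of degree \<open>d\<close>, \<open>germ_zero I P f\<close> says that the section of \<open>O(d)\<close> on the
  subscheme given by \<open>f\<close> vanishes in a neighbourhood of \<open>P\<close>.
\<close>

definition germ_zero ::
    "'k::field coord_ring set \<Rightarrow> 'k coord_ring set \<Rightarrow> 'k coord_ring \<Rightarrow> bool"
  where "germ_zero I P f \<longleftrightarrow> (\<exists>s. s \<notin> P \<and> s * f \<in> I)"

text \<open>A scheme is reduced iff none of its local rings has nonzero nilpotents.\<close>

definition reduced_scheme :: "'k::field coord_ring set \<Rightarrow> bool"
  where "reduced_scheme I \<longleftrightarrow>
    (\<forall>P\<in>zeros I. \<forall>d f g n. homogeneous d f \<longrightarrow> homogeneous d g \<longrightarrow> g \<notin> P \<longrightarrow>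
       germ_zero I P (f ^ n) \<longrightarrow> germ_zero I P f)"


section \<open>Points with coordinates in the ground field\<close>

text \<open>
  \<open>K\<close>-points of projective 3-space are lines through 0 in \<open>K\<^sup>4\<close>. Over an algebraically closed
  field they correspond, via \<open>point_ideal\<close>, to the closed points of \<^const>\<open>Proj\<close>.
\<close>

definition kpoints :: "'k::field coord_ring set set \<Rightarrow> ('k ^ 4) set set"
  where "kpoints Z = {L. vec.subspace L \<and> vec.dim L = 1 \<and> {f. \<forall>v\<in>L. poly_at f v = 0} \<in> Z}"

definition hpoint :: "'k::field \<Rightarrow> 'k \<Rightarrow> 'k \<Rightarrow> 'k \<Rightarrow> ('k ^ 4) set"
  where "hpoint a b c d = vec.span {vector [a, b, c, d]}"


section \<open>Automorphisms of a closed subscheme\<close>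

text \<open>
  A morphism from the subscheme of \<open>I\<close> to itself is given by charts \<open>(U, f)\<close>: on the open set
  \<open>U\<close> it is \<open>[f\<^sub>1 : f\<^sub>2 : f\<^sub>3 : f\<^sub>4]\<close> with \<open>f\<^sub>i\<close> homogeneous of equal degree and without common zero
  on \<open>U\<close>. The equations of the target must vanish after substitution, and two charts must agree
  on overlaps; both are required in the structure sheaf, not just pointwise.
\<close>

type_synonym 'k chart = "'k coord_ring set set \<times> ('k coord_ring ^ 4)"

definition is_chart :: "'k::field coord_ring set \<Rightarrow> 'k chart \<Rightarrow> bool"
  where "is_chart I c \<longleftrightarrow> (case c of (U, f) \<Rightarrow>
    openin (scheme_space I) U \<and>
    (\<exists>d. \<forall>i. homogeneous d (f $ i)) \<and>
    (\<forall>P\<in>U. \<exists>i. f $ i \<notin> P) \<and>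
    (\<forall>F\<in>I. \<forall>P\<in>U. germ_zero I P (poly_subst F f)))"

definition scheme_endo :: "'k::field coord_ring set \<Rightarrow> 'k chart set \<Rightarrow> bool"
  where "scheme_endo I C \<longleftrightarrow>
    (\<forall>c\<in>C. is_chart I c) \<and>
    (\<Union>c\<in>C. fst c) = zeros I \<and>
    (\<forall>(U, f)\<in>C. \<forall>(W, g)\<in>C. \<forall>P\<in>U \<inter> W. \<forall>i j.
       germ_zero I P (f $ i * g $ j - f $ j * g $ i))"

definition image_point ::
    "'k::field coord_ring ^ 4 \<Rightarrow> 'k coord_ring set \<Rightarrow> 'k coord_ring set"
  where "image_point f P = {F. \<forall>d. poly_subst (hcomp d F) f \<in> P}"

text \<open>The morphism with charts \<open>C\<close> followed by the one with charts \<open>D\<close> is the identity.\<close>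

definition comp_is_id :: "'k::field coord_ring set \<Rightarrow> 'k chart set \<Rightarrow> 'k chart set \<Rightarrow> bool"
  where "comp_is_id I C D \<longleftrightarrow>
    (\<forall>(U, f)\<in>C. \<forall>(W, g)\<in>D. \<forall>P\<in>U. image_point f P \<in> W \<longrightarrow>
       (\<forall>i j. germ_zero I P (poly_subst (g $ i) f * Xv j - poly_subst (g $ j) f * Xv i)))"

text \<open>The map \<open>t\<close> is the action on closed points of an automorphism of the scheme.\<close>

definition scheme_automorphism ::
    "'k::field coord_ring set \<Rightarrow> (('k ^ 4) set \<Rightarrow> ('k ^ 4) set) \<Rightarrow> bool"
  where "scheme_automorphism I t \<longleftrightarrow>
    (\<exists>C D. scheme_endo I C \<and> scheme_endo I D \<and> comp_is_id I C D \<and> comp_is_id I D C \<and>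
       (\<forall>(U, f)\<in>C. \<forall>L\<in>kpoints U. \<forall>v\<in>L. v \<noteq> 0 \<longrightarrow>
          t L = vec.span {\<chi> i. poly_at (f $ i) v}))"


section \<open>Point scheme\<close>

text \<open>
  A quadratic algebra enters through its six defining relations \<open>rel\<close>. If the \<open>r\<close>-th relation
  is \<open>\<Sum>\<^sub>i\<^sub>j c\<^sub>i\<^sub>j x\<^sub>i x\<^sub>j\<close>, then the entry \<open>(r, j)\<close> of the matrix \<open>M\<close> with \<open>M x = 0\<close> is
  \<open>\<Sum>\<^sub>i c\<^sub>i\<^sub>j x\<^sub>i\<close>.
\<close>

definition relation_matrix :: "'k::field free_algebra ^ 6 \<Rightarrow> 'k coord_ring ^ 4 ^ 6"
  where "relation_matrix rel =
    (\<chi> r j. \<Sum>i\<in>UNIV.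
       Poly_Mapping.single (Poly_Mapping.single i 1) (Poly_Mapping.lookup (rel $ r) (Word [i, j])))"

definition minors4 :: "'k::field coord_ring ^ 4 ^ 6 \<Rightarrow> 'k coord_ring set"
  where "minors4 M = {det (\<chi> i. M $ s i) | s :: 4 \<Rightarrow> 6. strict_mono s}"

definition point_scheme_ideal :: "'k::field free_algebra ^ 6 \<Rightarrow> 'k coord_ring set"
  where "point_scheme_ideal rel = genideal coord_ring (minors4 (relation_matrix rel))"

definition matrix_at :: "'k::field free_algebra ^ 6 \<Rightarrow> 'k ^ 4 \<Rightarrow> 'k ^ 4 ^ 6"
  where "matrix_at rel v = (\<chi> r j. poly_at (relation_matrix rel $ r $ j) v)"

text \<open>
  The kernel of \<open>M(p)\<close>; it does not depend on the nonzero vector representing \<open>p\<close>, and it is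
  itself a point of projective 3-space when \<open>M(p)\<close> has rank three.
\<close>

definition tau :: "'k::field free_algebra ^ 6 \<Rightarrow> ('k ^ 4) set \<Rightarrow> ('k ^ 4) set"
  where "tau rel L = {w. \<forall>v\<in>L. matrix_at rel v *v w = 0}"


section \<open>Planes and lines\<close>

definition plane :: "4 \<Rightarrow> 'k::field coord_ring set set"
  where "plane i = zeros
    {(vector [Xv 1 - Xv 2, Xv 1 + Xv 2, Xv 3 - Xv 4, Xv 3 + Xv 4] :: 'k coord_ring ^ 4) $ i}"

definition E12 :: "'k::field coord_ring set set" where "E12 = zeros {Xv 1, Xv 2}"
definition E34 :: "'k::field coord_ring set set" where "E34 = zeros {Xv 3, Xv 4}"
definition E13 :: "'k::field coord_ring set set" where "E13 = zeros {Xv 1 - Xv 2, Xv 3 - Xv 4}"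
definition E24 :: "'k::field coord_ring set set" where "E24 = zeros {Xv 1 + Xv 2, Xv 3 + Xv 4}"
definition E23 :: "'k::field coord_ring set set" where "E23 = zeros {Xv 1 + Xv 2, Xv 3 - Xv 4}"
definition E14 :: "'k::field coord_ring set set" where "E14 = zeros {Xv 1 - Xv 2, Xv 3 + Xv 4}"

end

theory Submission
  imports Defs "HOL-Computational_Algebra.Fraction_Field"
begin

no_notation fps_nth (infixl "$" 75)

text \<open>
  In the coordinates \<open>y = (x\<^sub>1 - x\<^sub>2, x\<^sub>1 + x\<^sub>2, x\<^sub>3 - x\<^sub>4, x\<^sub>3 + x\<^sub>4)\<close> the six lines are the edges
  of the coordinate tetrahedron, and the intersection \<open>J\<close> of their ideals is generated by the products
  of three of the \<open>y\<^sub>i\<close>. On each line the matrix \<open>M\<close> has a nonzero kernel vector, so all minors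
  lie in \<open>J\<close>; conversely \<open>x\<^sub>k\<^sup>2 J\<close> lies in the ideal of minors \<open>I\<close> for every \<open>k\<close>. (The factor
  \<open>x\<^sub>k\<close> would not suffice: in degree 4, \<open>I\<close> misses \<open>y\<^sub>1 y\<^sub>2 y\<^sub>3 y\<^sub>4\<close>.) As some \<open>x\<^sub>k\<close> lies outside any
  given point, \<open>I\<close> and \<open>J\<close> define the same scheme, which is therefore reduced. Away from
  the plane \<open>y\<^sub>v = 0\<close> only three lines remain, and they are concurrent; there \<open>\<tau>\<close> is
  induced by a linear map, and these four linear maps are the charts of \<open>\<tau>\<close>, which is an involution.
\<close>

section \<open>Vectors, determinants and ring homomorphisms\<close>

text \<open>The points of \<open>Proj\<close> include the generic points of the lines, and germs are
  compared in the structure sheaf, so checking K-points is not enough. The remedy is a generic point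
  for each line: its parametrization with two of the variables as parameters. An element of J is one
  that becomes zero under these six substitutions. A claim about germs of charts thus becomes an
  identity over a polynomial ring, checked line by line after multiplication by a form that avoids
  the given point and kills the lines on which the identity may fail. For this reason
  \<open>pt\<close>, \<open>hyp\<close>, \<open>chart\<close> and \<open>rel_mat\<close> are defined
  over arbitrary commutative rings and are transported along ring homomorphisms. Characteristic zero
  makes 2 invertible and the field infinite. Algebraic closedness enters in the dimension: a
  homogeneous prime strictly above a line ideal contains a nonzero binary form in the two
  parameters, hence one of its linear factors, and is therefore the ideal of a K-point.\<close>

lemma vector_4 [simp]:
  "(vector [a, b, c, d] :: 'a::zero ^ 4) $ 1 = a"
  "(vector [a, b, c, d] :: 'a::zero ^ 4) $ 2 = b"
  "(vector [a, b, c, d] :: 'a::zero ^ 4) $ 3 = c"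
  "(vector [a, b, c, d] :: 'a::zero ^ 4) $ 4 = d"
  unfolding vector_def by simp_all

lemma vector_6 [simp]:
  "(vector [a, b, c, d, e, f] :: 'a::zero ^ 6) $ 1 = a"
  "(vector [a, b, c, d, e, f] :: 'a::zero ^ 6) $ 2 = b"
  "(vector [a, b, c, d, e, f] :: 'a::zero ^ 6) $ 3 = c"
  "(vector [a, b, c, d, e, f] :: 'a::zero ^ 6) $ 4 = d"
  "(vector [a, b, c, d, e, f] :: 'a::zero ^ 6) $ 5 = e"
  "(vector [a, b, c, d, e, f] :: 'a::zero ^ 6) $ 6 = f"
  unfolding vector_def by simp_all

lemma exhaust_6:
  fixes x :: 6
  shows "x = 1 \<or> x = 2 \<or> x = 3 \<or> x = 4 \<or> x = 5 \<or> x = 6"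
proof (induct x)
  case (of_int z)
  then have "z = 0 \<or> z = 1 \<or> z = 2 \<or> z = 3 \<or> z = 4 \<or> z = 5"
    by simp arith
  then show ?case
    by auto
qed

lemma forall_6: "(\<forall>i::6. P i) \<longleftrightarrow> P 1 \<and> P 2 \<and> P 3 \<and> P 4 \<and> P 5 \<and> P 6"
  by (metis exhaust_6)

text \<open>The numeral 4 denotes 0 in this type, so the order is \<open>4 < 1 < 2 < 3\<close>, and
  likewise 6 is the least element of type \<open>6\<close>. This decides which row selections in
  \<open>minors4\<close> are strictly monotone.\<close>

lemma less_numeral_4 [simp]:
  "\<not> (1::4) < 4" "(1::4) < 2" "(1::4) < 3" "\<not> (2::4) < 1" "(2::4) < 3" "\<not> (2::4) < 4"
  "\<not> (3::4) < 1" "\<not> (3::4) < 2" "\<not> (3::4) < 4" "(4::4) < 1" "(4::4) < 2" "(4::4) < 3"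
  by (simp_all add: less_bit0_def bit0.Rep_numeral bit0.Rep_1)

lemma less_numeral_6 [simp]:
  "(6::6) < 1" "(6::6) < 2" "(6::6) < 3" "(1::6) < 2" "(1::6) < 3" "(2::6) < 3"
  "(2::6) < 4" "(2::6) < 5" "(3::6) < 4" "(3::6) < 5" "(4::6) < 5"
  by (simp_all add: less_bit0_def bit0.Rep_numeral bit0.Rep_1)

text \<open>Every permutation is a unique product of this shape: \<open>b\<close> is the image of 1,
  and what remains permutes 2, 3, 4, where the same splitting is repeated.\<close>

lemma sum_permutes_4:
  "(\<Sum>p | p permutes (UNIV :: 4 set). f p) = (\<Sum>b\<in>{1,2,3,4}. \<Sum>c\<in>{2,3,4}. \<Sum>d\<in>{3,4}.
    f (Transposition.transpose 1 b \<circ> (Transposition.transpose 2 c \<circ> Transposition.transpose 3 d)))"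
proof -
  have f1: "finite {2::4, 3, 4}" "1 \<notin> {2::4, 3, 4}" by auto
  have f2: "finite {3::4, 4}" "2 \<notin> {3::4, 4}" by auto
  have f3: "finite {4::4}" "3 \<notin> {4::4}" by auto
  show ?thesis
    unfolding UNIV_4 sum_over_permutations_insert[OF f1] sum_over_permutations_insert[OF f2]
      sum_over_permutations_insert[OF f3] permutes_sing by simp
qed

lemma sign_transpose_3:
  "sign (Transposition.transpose a b \<circ> (Transposition.transpose c d \<circ> Transposition.transpose e f)) =
    (if a = b then 1 else -1) * (if c = d then 1 else -1) * (if e = f then 1 else -1)"
  for a :: "'a::finite"
  by (simp add: sign_compose permutation_compose permutation_swap_id sign_swap_id)

lemma prod_4: "prod f (UNIV :: 4 set) = f 1 * f 2 * f 3 * f 4"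
  unfolding UNIV_4 by (simp add: ac_simps)

lemma det_4:
  fixes A :: "'a::comm_ring_1 ^ 4 ^ 4"
  shows "det A =
     A $ 1 $ 1 * (A $ 2 $ 2 * (A $ 3 $ 3 * A $ 4 $ 4 - A $ 3 $ 4 * A $ 4 $ 3) - A $ 2 $ 3 * (A $ 3 $ 2 * A $ 4 $ 4 - A $ 3 $ 4 * A $ 4 $ 2)
       + A $ 2 $ 4 * (A $ 3 $ 2 * A $ 4 $ 3 - A $ 3 $ 3 * A $ 4 $ 2))
   - A $ 1 $ 2 * (A $ 2 $ 1 * (A $ 3 $ 3 * A $ 4 $ 4 - A $ 3 $ 4 * A $ 4 $ 3) - A $ 2 $ 3 * (A $ 3 $ 1 * A $ 4 $ 4 - A $ 3 $ 4 * A $ 4 $ 1)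
       + A $ 2 $ 4 * (A $ 3 $ 1 * A $ 4 $ 3 - A $ 3 $ 3 * A $ 4 $ 1))
   + A $ 1 $ 3 * (A $ 2 $ 1 * (A $ 3 $ 2 * A $ 4 $ 4 - A $ 3 $ 4 * A $ 4 $ 2) - A $ 2 $ 2 * (A $ 3 $ 1 * A $ 4 $ 4 - A $ 3 $ 4 * A $ 4 $ 1)
       + A $ 2 $ 4 * (A $ 3 $ 1 * A $ 4 $ 2 - A $ 3 $ 2 * A $ 4 $ 1))
   - A $ 1 $ 4 * (A $ 2 $ 1 * (A $ 3 $ 2 * A $ 4 $ 3 - A $ 3 $ 3 * A $ 4 $ 2) - A $ 2 $ 2 * (A $ 3 $ 1 * A $ 4 $ 3 - A $ 3 $ 3 * A $ 4 $ 1)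
       + A $ 2 $ 3 * (A $ 3 $ 1 * A $ 4 $ 2 - A $ 3 $ 2 * A $ 4 $ 1))"
proof -
  have sums: "sum g {1, 2, 3, 4::4} = g 1 + (g 2 + (g 3 + g 4))" "sum g {2, 3, 4::4} = g 2 + (g 3 + g 4)"
    "sum g {3, 4::4} = g 3 + g 4" for g :: "4 \<Rightarrow> 'a"
    by simp_all
  have ne: "(1::4) \<noteq> 2" "(1::4) \<noteq> 3" "(1::4) \<noteq> 4" "(2::4) \<noteq> 1" "(2::4) \<noteq> 3" "(2::4) \<noteq> 4"
    "(3::4) \<noteq> 1" "(3::4) \<noteq> 2" "(3::4) \<noteq> 4" "(4::4) \<noteq> 1" "(4::4) \<noteq> 2" "(4::4) \<noteq> 3"
    by simp_all
  show ?thesis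
    unfolding det_def sum_permutes_4 sums sign_transpose_3 prod_4
    by (simp only: o_apply transpose_apply_first transpose_apply_second transpose_apply_other ne
        not_False_eq_True if_True if_False refl of_int_mult of_int_minus of_int_1
        mult_1_left mult_1_right mult_minus_left mult_minus_right minus_minus)
      (simp add: algebra_simps)
qed

section \<open>Ideals of the coordinate ring and ring homomorphisms\<close>

lemma ideal_coord_ring_iff:
  "ideal J (coord_ring :: 'k::field coord_ring ring) \<longleftrightarrow>
     0 \<in> J \<and> (\<forall>f\<in>J. \<forall>g\<in>J. f + g \<in> J) \<and> (\<forall>f\<in>J. \<forall>g. g * f \<in> J)"
proof
  assume "ideal J (coord_ring :: 'k coord_ring ring)"
  then interpret ideal J "coord_ring :: 'k coord_ring ring" .
  show "0 \<in> J \<and> (\<forall>f\<in>J. \<forall>g\<in>J. f + g \<in> J) \<and> (\<forall>f\<in>J. \<forall>g. g * f \<in> J)"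
    using additive_subgroup.zero_closed[OF is_additive_subgroup]
      additive_subgroup.a_closed[OF is_additive_subgroup] I_l_closed
    by (simp add: ring_of_type_algebra_def)
next
  assume J: "0 \<in> J \<and> (\<forall>f\<in>J. \<forall>g\<in>J. f + g \<in> J) \<and> (\<forall>f\<in>J. \<forall>g. g * f \<in> J)"
  have neg: "- f \<in> J" if "f \<in> J" for f
    using J that by (metis mult_minus1)
  interpret cring "coord_ring :: 'k coord_ring ring" by (rule cring_from_type_algebra)
  have uminus: "\<ominus>\<^bsub>coord_ring\<^esub> f = - f" for f :: "'k coord_ring"
    by (rule minus_equality) (simp_all add: ring_of_type_algebra_def)
  show "ideal J (coord_ring :: 'k coord_ring ring)"
  proof (rule idealI)
    show "ring (coord_ring :: 'k coord_ring ring)" by (rule ring_axioms)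
    show "subgroup J (add_monoid (coord_ring :: 'k coord_ring ring))"
    proof (intro subgroup.intro)
      show "inv\<^bsub>add_monoid coord_ring\<^esub> f \<in> J" if "f \<in> J" for f
        using neg[OF that] uminus[of f] by (simp add: a_inv_def)
    qed (use J in \<open>auto simp: ring_of_type_algebra_def\<close>)
  qed (use J in \<open>auto simp: ring_of_type_algebra_def mult.commute\<close>)
qed

locale rhom =
  fixes h :: "'a::comm_ring_1 \<Rightarrow> 'b::comm_ring_1"
  assumes add: "h (x + y) = h x + h y"
    and mult: "h (x * y) = h x * h y"
    and one: "h 1 = 1"
begin

lemma zero: "h 0 = 0"
  using add[of 0 0] by simp

lemma uminus: "h (- x) = - h x"
  using add[of x "- x"] by (simp add: zero add_eq_0_iff)

lemma diff: "h (x - y) = h x - h y"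
  using add[of x "- y"] by (simp add: uminus)

lemma sum: "h (sum f A) = (\<Sum>x\<in>A. h (f x))"
  by (induction A rule: infinite_finite_induct) (simp_all add: zero add)

lemma prod: "h (prod f A) = (\<Prod>x\<in>A. h (f x))"
  by (induction A rule: infinite_finite_induct) (simp_all add: one mult)

lemma power: "h (x ^ n) = h x ^ n"
  by (induction n) (simp_all add: one mult)

lemma of_int: "h (of_int z) = of_int z"
proof -
  have "h (of_nat n) = of_nat n" for n
    by (induction n) (simp_all add: zero one add)
  then show ?thesis by (cases z) (simp_all add: uminus diff one)
qed

lemma numeral: "h (numeral k) = numeral k"
  using of_int[of "numeral k"] by simp

lemma det: "h (det A) = det (\<chi> i j. h (A $ i $ j))"
  by (simp add: det_def sum mult prod of_int)

lemmas simps = add mult one zero uminus diff power numeral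

end

lemma rhom_id: "rhom (\<lambda>x. x)"
  by (simp add: rhom_def)

section \<open>Evaluation of polynomials\<close>

abbreviation cst :: "'k::field \<Rightarrow> 'k coord_ring"
  where "cst \<equiv> Poly_Mapping.single 0"

abbreviation Xvec :: "'k::field coord_ring ^ 4"
  where "Xvec \<equiv> \<chi> i. Xv i"

lemma rhom_cst: "rhom cst"
  by unfold_locales (simp_all add: single_add mult_single)

definition eval_mon :: "'b::comm_ring_1 ^ 4 \<Rightarrow> (4 \<Rightarrow>\<^sub>0 nat) \<Rightarrow> 'b"
  where "eval_mon x m = (\<Prod>i\<in>UNIV. (x $ i) ^ Poly_Mapping.lookup m i)"

text \<open>Common generalization of evaluation and substitution: coefficients pass through
  \<open>\<phi>\<close>, which is the identity for \<open>poly_at\<close> and \<open>cst\<close> for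
  \<open>poly_subst\<close>. Both then inherit the homomorphism and composition laws from one
  proof.\<close>

definition ev :: "('k::field \<Rightarrow> 'b::comm_ring_1) \<Rightarrow> 'k coord_ring \<Rightarrow> 'b ^ 4 \<Rightarrow> 'b"
  where "ev \<phi> f x = (\<Sum>m\<in>Poly_Mapping.keys f. \<phi> (Poly_Mapping.lookup f m) * eval_mon x m)"

lemma poly_at_eq_ev: "poly_at f v = ev (\<lambda>c. c) f v"
  by (simp add: poly_at_def ev_def eval_mon_def)

lemma poly_subst_eq_ev: "poly_subst f g = ev cst f g"
  by (simp add: poly_subst_def ev_def eval_mon_def)

lemma eval_mon_0 [simp]: "eval_mon x 0 = 1"
  by (simp add: eval_mon_def)

lemma eval_mon_add: "eval_mon x (m + n) = eval_mon x m * eval_mon x n"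
  by (simp add: eval_mon_def lookup_add power_add prod.distrib)

lemma eval_mon_single [simp]: "eval_mon x (Poly_Mapping.single i n) = (x $ i) ^ n"
proof -
  have "eval_mon x (Poly_Mapping.single i n) = (\<Prod>j\<in>UNIV. if j = i then (x $ i) ^ n else 1)"
    unfolding eval_mon_def by (rule prod.cong) (auto simp: lookup_single when_def)
  then show ?thesis by simp
qed

lemma poly_mapping_sum_single:
  "f = (\<Sum>m\<in>Poly_Mapping.keys f. Poly_Mapping.single m (Poly_Mapping.lookup f m))"
  by (rule poly_mapping_eqI)
    (auto simp: lookup_sum lookup_single when_def in_keys_iff sum.delta)

lemma Xv_power: "Xv i ^ n = Poly_Mapping.single (Poly_Mapping.single i n) 1"
  by (induction n) (simp_all add: Xv_def mult_single single_add[symmetric] flip: single_one)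

lemma eval_mon_Xvec: "eval_mon Xvec m = Poly_Mapping.single m (1::'k::field)"
proof -
  have *: "(\<Prod>i\<in>S. Poly_Mapping.single (Poly_Mapping.single i (Poly_Mapping.lookup m i)) (1::'k)) =
      Poly_Mapping.single (\<Sum>i\<in>S. Poly_Mapping.single i (Poly_Mapping.lookup m i)) 1" for S :: "4 set"
    by (induction S rule: infinite_finite_induct) (simp_all add: mult_single)
  have "(\<Sum>i\<in>UNIV. Poly_Mapping.single i (Poly_Mapping.lookup m i)) = m"
    by (rule poly_mapping_eqI) (auto simp: lookup_sum lookup_single when_def)
  then show ?thesis
    by (simp add: eval_mon_def Xv_power *)
qed

lemma ev_superset:
  assumes "rhom \<phi>" "finite A" "Poly_Mapping.keys f \<subseteq> A"
  shows "ev \<phi> f x = (\<Sum>m\<in>A. \<phi> (Poly_Mapping.lookup f m) * eval_mon x m)"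
  unfolding ev_def
  by (rule sum.mono_neutral_left) (use assms in \<open>auto simp: in_keys_iff rhom.zero\<close>)

lemma ev_add:
  assumes "rhom \<phi>"
  shows "ev \<phi> (f + g) x = ev \<phi> f x + ev \<phi> g x"
  using ev_superset[OF assms, of "Poly_Mapping.keys f \<union> Poly_Mapping.keys g"]
  by (simp add: keys_add lookup_add rhom.add[OF assms] distrib_right sum.distrib)

lemma ev_single:
  assumes "rhom \<phi>"
  shows "ev \<phi> (Poly_Mapping.single m c) x = \<phi> c * eval_mon x m"
  using ev_superset[OF assms, of "{m}" "Poly_Mapping.single m c"] by simp

lemma ev_sum:
  assumes "rhom \<phi>"
  shows "ev \<phi> (sum f A) x = (\<Sum>a\<in>A. ev \<phi> (f a) x)"
proof -
  have "ev \<phi> 0 x = 0" by (simp add: ev_def)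
  then show ?thesis
    by (induction A rule: infinite_finite_induct) (simp_all add: ev_add[OF assms])
qed

lemma rhom_ev:
  assumes "rhom \<phi>"
  shows "rhom (\<lambda>f. ev \<phi> f x)"
proof
  fix f g
  show "ev \<phi> (f + g) x = ev \<phi> f x + ev \<phi> g x" by (rule ev_add[OF assms])
  have "f * g = (\<Sum>m\<in>Poly_Mapping.keys f. \<Sum>n\<in>Poly_Mapping.keys g.
      Poly_Mapping.single (m + n) (Poly_Mapping.lookup f m * Poly_Mapping.lookup g n))"
    by (subst poly_mapping_sum_single[of f], subst poly_mapping_sum_single[of g])
      (simp add: sum_product mult_single)
  then show "ev \<phi> (f * g) x = ev \<phi> f x * ev \<phi> g x"
    by (simp add: ev_sum[OF assms] ev_single[OF assms] eval_mon_add rhom.mult[OF assms])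
      (simp add: ev_def sum_product algebra_simps)
next
  show "ev \<phi> 1 x = 1"
    using ev_single[OF assms, of 0 1 x] by (simp add: rhom.one[OF assms])
qed

lemma ev_Xv [simp]: "rhom \<phi> \<Longrightarrow> ev \<phi> (Xv i) x = x $ i"
  by (simp add: Xv_def ev_single rhom.one)

lemma ev_cst [simp]: "rhom \<phi> \<Longrightarrow> ev \<phi> (cst c) x = \<phi> c"
  by (simp add: ev_single)

lemma rhom_eval_mon: "rhom h \<Longrightarrow> h (eval_mon x m) = eval_mon (\<chi> i. h (x $ i)) m"
  by (simp add: eval_mon_def rhom.prod rhom.power)

lemma rhom_of_ev: "rhom h \<Longrightarrow> h (ev \<phi> f x) = ev (\<lambda>c. h (\<phi> c)) f (\<chi> i. h (x $ i))"
  by (simp add: ev_def rhom.sum rhom.mult rhom_eval_mon)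

lemma ev_Xvec: "ev cst f Xvec = f"
  using poly_mapping_sum_single[of f] by (simp add: ev_def eval_mon_Xvec mult_single)

lemmas rhom_poly_subst = rhom_ev[OF rhom_cst, folded poly_subst_eq_ev]
lemmas rhom_poly_at = rhom_ev[OF rhom_id, folded poly_at_eq_ev]

lemma poly_subst_poly_subst:
  "poly_subst (poly_subst f g) h = poly_subst f (\<chi> i. poly_subst (g $ i) h)"
  using rhom_of_ev[OF rhom_poly_subst, of cst f g h] by (simp add: poly_subst_eq_ev rhom_cst)

lemma poly_at_poly_subst:
  "poly_at (poly_subst f g) v = poly_at f (\<chi> i. poly_at (g $ i) v)"
  using rhom_of_ev[OF rhom_poly_at, of cst f g v] by (simp add: poly_subst_eq_ev poly_at_eq_ev rhom_id)

lemma poly_subst_Xvec [simp]: "poly_subst f Xvec = f"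
  by (simp add: poly_subst_eq_ev ev_Xvec)

lemma poly_subst_Xv [simp]: "poly_subst (Xv i) g = g $ i"
  by (simp add: poly_subst_eq_ev rhom_cst)

lemma poly_at_Xv [simp]: "poly_at (Xv i) v = v $ i"
  by (simp add: poly_at_eq_ev rhom_id)

lemma poly_subst_cst [simp]: "poly_subst (cst c) g = cst c"
  by (simp add: poly_subst_eq_ev rhom_cst)

lemma poly_at_cst [simp]: "poly_at (cst c) v = c"
  by (simp add: poly_at_eq_ev rhom_id)

section \<open>Homogeneous components\<close>

lemma lookup_hcomp:
  "Poly_Mapping.lookup (hcomp d f) m = (if mdegree m = d then Poly_Mapping.lookup f m else 0)"
proof -
  have "Poly_Mapping.lookup (hcomp d f) m = (\<Sum>n | n \<in> Poly_Mapping.keys f \<and> mdegree n = d.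
      if n = m then Poly_Mapping.lookup f m else 0)"
    unfolding hcomp_def lookup_sum by (rule sum.cong) (auto simp: lookup_single when_def)
  also have "\<dots> = (if mdegree m = d then Poly_Mapping.lookup f m else 0)"
    by (auto simp: sum.delta in_keys_iff)
  finally show ?thesis .
qed

lemma hcomp_add: "hcomp d (f + g) = hcomp d f + hcomp d g"
  by (rule poly_mapping_eqI) (simp add: lookup_hcomp lookup_add)

lemma hcomp_0 [simp]: "hcomp d 0 = 0"
  by (rule poly_mapping_eqI) (simp add: lookup_hcomp)

lemma hcomp_sum: "hcomp d (sum f A) = (\<Sum>a\<in>A. hcomp d (f a))"
  by (induction A rule: infinite_finite_induct) (simp_all add: hcomp_add)

lemma homogeneousD: "homogeneous d f \<Longrightarrow> Poly_Mapping.lookup f m \<noteq> 0 \<Longrightarrow> mdegree m = d"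
  by (auto simp: homogeneous_def in_keys_iff)

lemma homogeneousI:
  "(\<And>m. Poly_Mapping.lookup f m \<noteq> 0 \<Longrightarrow> mdegree m = d) \<Longrightarrow> homogeneous d f"
  by (auto simp: homogeneous_def in_keys_iff)

lemma homogeneous_hcomp: "homogeneous d (hcomp d f)"
  by (rule homogeneousI) (auto simp: lookup_hcomp split: if_splits)

lemma hcomp_homogeneous: "homogeneous e f \<Longrightarrow> hcomp d f = (if d = e then f else 0)"
  by (rule poly_mapping_eqI) (auto simp: lookup_hcomp dest: homogeneousD)

lemma hcomp_decomposition: "\<exists>D. f = (\<Sum>d\<le>D. hcomp d f)"
proof -
  \<comment> \<open>A crude bound on the degree: the sum over all monomials dominates each summand
    and also makes sense for the zero polynomial.\<close>
  define D where "D = (\<Sum>m\<in>Poly_Mapping.keys f. mdegree m)"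
  have "mdegree m \<le> D" if "Poly_Mapping.lookup f m \<noteq> 0" for m
    unfolding D_def by (rule member_le_sum) (use that in \<open>auto simp: in_keys_iff\<close>)
  then have "f = (\<Sum>d\<le>D. hcomp d f)"
    by (intro poly_mapping_eqI) (auto simp: lookup_sum lookup_hcomp)
  then show ?thesis ..
qed

lemma hcomp_hcomp: "hcomp d (hcomp e f) = (if d = e then hcomp d f else 0)"
  by (simp add: hcomp_homogeneous[OF homogeneous_hcomp])

lemma mdegree_add: "mdegree (m + n) = mdegree m + mdegree n"
  by (simp add: mdegree_def lookup_add sum.distrib)

lemma mdegree_single [simp]: "mdegree (Poly_Mapping.single i n) = n"
  by (simp add: mdegree_def lookup_single when_def)

lemma mdegree_0 [simp]: "mdegree 0 = 0"
  by (simp add: mdegree_def)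

lemma homogeneous_add: "homogeneous d f \<Longrightarrow> homogeneous d g \<Longrightarrow> homogeneous d (f + g)"
  using keys_add[of f g] by (auto simp: homogeneous_def)

lemma homogeneous_uminus: "homogeneous d f \<Longrightarrow> homogeneous d (- f)"
  by (simp add: homogeneous_def in_keys_iff)

lemma homogeneous_diff: "homogeneous d f \<Longrightarrow> homogeneous d g \<Longrightarrow> homogeneous d (f - g)"
  using homogeneous_add[OF _ homogeneous_uminus] by fastforce

lemma homogeneous_0 [simp]: "homogeneous d 0"
  by (simp add: homogeneous_def)

lemma homogeneous_mult: "homogeneous d f \<Longrightarrow> homogeneous e g \<Longrightarrow> homogeneous (d + e) (f * g)"
  using keys_mult[of f g] by (fastforce simp: homogeneous_def mdegree_add)

lemma homogeneous_cst: "homogeneous 0 (cst c)"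
  by (auto intro!: homogeneousI simp: lookup_single when_def split: if_splits)

lemma homogeneous_Xv: "homogeneous 1 (Xv i)"
  by (auto intro!: homogeneousI simp: Xv_def lookup_single when_def split: if_splits)

lemma homogeneous_cst_mult: "homogeneous d f \<Longrightarrow> homogeneous d (cst c * f)"
  using homogeneous_mult[OF homogeneous_cst] by fastforce

lemma homogeneous_power: "homogeneous d f \<Longrightarrow> homogeneous (n * d) (f ^ n)"
  by (induction n) (auto dest: homogeneous_mult simp: homogeneous_cst[of 1, simplified])

lemma homogeneous_prod:
  "(\<And>i. i \<in> A \<Longrightarrow> homogeneous (d i) (f i)) \<Longrightarrow> homogeneous (sum d A) (prod f A)"
  by (induction A rule: infinite_finite_induct)
    (auto intro: homogeneous_mult simp: homogeneous_cst[of 1, simplified])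

lemma homogeneous_eval_mon:
  assumes "\<And>i. homogeneous 1 (g $ i)"
  shows "homogeneous (mdegree m) (eval_mon g m)"
  unfolding eval_mon_def mdegree_def
  by (rule homogeneous_prod) (use homogeneous_power[OF assms] in simp)

text \<open>A linear substitution preserves degrees. Hence its kernel is a homogeneous
  ideal.\<close>

lemma hcomp_poly_subst:
  assumes g: "\<And>i. homogeneous 1 (g $ i)"
  shows "hcomp d (poly_subst f g) = poly_subst (hcomp d f) g"
proof -
  have *: "hcomp d (poly_subst (Poly_Mapping.single m c) g) = poly_subst (hcomp d (Poly_Mapping.single m c)) g" for m c
  proof -
    have "homogeneous (mdegree m) (Poly_Mapping.single m c)"
      by (auto intro!: homogeneousI simp: lookup_single when_def split: if_splits)
    moreover have "homogeneous (mdegree m) (cst c * eval_mon g m)"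
      by (rule homogeneous_cst_mult[OF homogeneous_eval_mon[OF g]])
    ultimately show ?thesis
      by (simp add: poly_subst_eq_ev ev_single rhom_cst hcomp_homogeneous rhom.zero[OF rhom_ev])
  qed
  show ?thesis
    by (subst (1 2) poly_mapping_sum_single[of f])
      (simp add: rhom.sum[OF rhom_poly_subst] hcomp_sum *)
qed

text \<open>Homogeneity in two guises. With the identity for \<open>\<phi>\<close> it is the scaling
  rule for values; with \<open>cst\<close> it says that restricting \<open>f\<close> to the line
  through \<open>v\<close>, parametrized by \<open>l\<close>, leaves the single term f(v)
  l^d.\<close>

lemma ev_homogeneous_line:
  assumes \<phi>: "rhom \<phi>" and f: "homogeneous d f"
  shows "ev \<phi> f (\<chi> i. \<phi> (v $ i) * l) = \<phi> (poly_at f v) * l ^ d"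
proof -
  have "eval_mon (\<chi> i. \<phi> (v $ i) * l) m = \<phi> (eval_mon v m) * l ^ mdegree m" for m
    by (simp add: eval_mon_def mdegree_def power_mult_distrib prod.distrib power_sum
        rhom.prod[OF \<phi>] rhom.power[OF \<phi>])
  then show ?thesis
    using f by (simp add: poly_at_eq_ev ev_def rhom.sum[OF \<phi>] rhom.mult[OF \<phi>] sum_distrib_right
        homogeneous_def mult.assoc)
qed

section \<open>Homogeneous primes\<close>

locale proj_point =
  fixes P :: "'k::field coord_ring set"
  assumes Proj: "P \<in> Proj"
begin

lemma primeideal: "primeideal P coord_ring"
  using Proj by (simp add: Proj_def)

lemma ideal_closure:
  "0 \<in> P" "f \<in> P \<Longrightarrow> g \<in> P \<Longrightarrow> f + g \<in> P" "f \<in> P \<Longrightarrow> g * f \<in> P"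
  using primeideal.axioms(1)[OF primeideal] by (simp_all add: ideal_coord_ring_iff)

lemmas zero = ideal_closure(1) and add = ideal_closure(2) and mult_left = ideal_closure(3)

lemma mult_right: "f \<in> P \<Longrightarrow> f * g \<in> P"
  using mult_left[of f g] by (simp add: mult.commute)

lemma uminus: "f \<in> P \<Longrightarrow> - f \<in> P"
  using mult_left[of f "- 1"] by simp

lemma diff: "f \<in> P \<Longrightarrow> g \<in> P \<Longrightarrow> f - g \<in> P"
  using add[of f "- g"] uminus by simp

lemma sum: "(\<And>a. a \<in> A \<Longrightarrow> f a \<in> P) \<Longrightarrow> sum f A \<in> P"
  by (induction A rule: infinite_finite_induct) (simp_all add: zero add)

lemma mult_iff: "f * g \<in> P \<longleftrightarrow> f \<in> P \<or> g \<in> P"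
  using primeideal.I_prime[OF primeideal, of f g] mult_left mult_right
  by (auto simp: ring_of_type_algebra_def)

lemma one: "1 \<notin> P"
proof
  assume "1 \<in> P"
  then have "P = UNIV" using mult_right[of 1] by auto
  then show False using Proj by (simp add: Proj_def)
qed

lemma power: "f ^ n \<in> P \<Longrightarrow> f \<in> P"
  by (induction n) (auto simp: one mult_iff)

lemma cst: "c \<noteq> 0 \<Longrightarrow> cst c \<notin> P"
proof
  assume "c \<noteq> 0" "cst c \<in> P"
  then have "cst (1 / c) * cst c \<in> P" by (intro mult_left)
  then show False using \<open>c \<noteq> 0\<close> one by (simp add: mult_single)
qed

lemma hcomp: "f \<in> P \<Longrightarrow> hcomp d f \<in> P"
  using Proj by (simp add: Proj_def)

text \<open>If all variables lay in \<open>P\<close>, so would every nonconstant monomial and with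
  them the irrelevant ideal. This is the form in which that condition on points is used.\<close>

lemma ex_Xv: "\<exists>k. Xv k \<notin> P"
proof (rule ccontr)
  assume *: "\<not> (\<exists>k. Xv k \<notin> P)"
  have "f \<in> P" if f: "Poly_Mapping.lookup f 0 = 0" for f
  proof -
    have "Poly_Mapping.single m (Poly_Mapping.lookup f m) \<in> P" if "m \<in> Poly_Mapping.keys f" for m
    proof -
      from that f have "m \<noteq> 0" by (auto simp: in_keys_iff)
      then obtain k where k: "Poly_Mapping.lookup m k \<noteq> 0"
        by (metis poly_mapping_eqI lookup_zero)
      have "Xv k ^ Poly_Mapping.lookup m k \<in> P"
        using k * mult_right[of "Xv k"] by (cases "Poly_Mapping.lookup m k") simp_all
      then have "eval_mon Xvec m \<in> P"
        unfolding eval_mon_def by (subst prod.remove[of _ k]) (auto intro: mult_right)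
      then show ?thesis
        using mult_left[of "eval_mon Xvec m" "cst (Poly_Mapping.lookup f m)"]
        by (simp add: eval_mon_Xvec mult_single)
    qed
    then show "f \<in> P"
      by (subst poly_mapping_sum_single) (rule sum)
  qed
  then show False using Proj by (auto simp: Proj_def irrelevant_ideal_def)
qed

lemma cong_mult:
  assumes "a - b \<in> P" "c - d \<in> P"
  shows "a * c - b * d \<in> P"
proof -
  have "a * c - b * d = a * (c - d) + d * (a - b)" by (simp add: algebra_simps)
  then show ?thesis using assms by (simp add: add mult_left)
qed

lemma cong_power: "a - b \<in> P \<Longrightarrow> a ^ n - b ^ n \<in> P"
  by (induction n) (simp_all add: zero cong_mult)

lemma cong_prod: "(\<And>i. i \<in> A \<Longrightarrow> f i - g i \<in> P) \<Longrightarrow> prod f A - prod g A \<in> P"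
  by (induction A rule: infinite_finite_induct) (simp_all add: zero cong_mult)

lemma cong_poly_subst:
  assumes "\<And>i. x $ i - y $ i \<in> P"
  shows "poly_subst f x - poly_subst f y \<in> P"
proof -
  have "poly_subst f x - poly_subst f y = (\<Sum>m\<in>Poly_Mapping.keys f.
      cst (Poly_Mapping.lookup f m) * (eval_mon x m - eval_mon y m))"
    by (simp add: poly_subst_eq_ev ev_def sum_subtractf right_diff_distrib)
  also have "\<dots> \<in> P"
    unfolding eval_mon_def by (intro sum mult_left cong_prod cong_power assms)
  finally show ?thesis .
qed

lemma cong_mem: "a - b \<in> P \<Longrightarrow> a \<in> P \<longleftrightarrow> b \<in> P"
  using add[of "a - b" b] diff[of a "a - b"] by auto

lemma mem_if_hcomp: "(\<And>d. hcomp d f \<in> P) \<Longrightarrow> f \<in> P"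
  using hcomp_decomposition[of f] sum by metis

end

text \<open>A single variable outside \<open>P\<close> gives both properness and the condition on
  the irrelevant ideal.\<close>

lemma ProjI:
  assumes "0 \<in> P" "\<And>f g. f \<in> P \<Longrightarrow> g \<in> P \<Longrightarrow> f + g \<in> P" "\<And>f g. f \<in> P \<Longrightarrow> g * f \<in> P"
    and "\<And>f g. f * g \<in> P \<Longrightarrow> f \<in> P \<or> g \<in> P"
    and "\<And>f d. f \<in> P \<Longrightarrow> hcomp d f \<in> P"
    and "Xv k \<notin> P"
  shows "P \<in> Proj"
proof -
  have "P \<noteq> UNIV" using assms(6) by auto
  moreover have "Poly_Mapping.single k (1::nat) \<noteq> 0"
    by (metis lookup_single_eq lookup_zero zero_neq_one)
  then have "Xv k \<in> irrelevant_ideal"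
    by (simp add: irrelevant_ideal_def Xv_def lookup_single)
  moreover have "ideal P coord_ring"
    using assms(1-3) by (simp add: ideal_coord_ring_iff)
  then have "primeideal P coord_ring"
    using assms(4) \<open>P \<noteq> UNIV\<close>
    by (intro primeidealI cring_from_type_algebra) (auto simp: ring_of_type_algebra_def)
  ultimately show ?thesis
    using assms(5,6) unfolding Proj_def by auto
qed

text \<open>The kernel of a homomorphism into a domain is prime, and linearity of \<open>g\<close>
  makes it homogeneous. Generic points of lines and ideals of K-points are both obtained in this
  way.\<close>

lemma kernel_in_Proj:
  fixes g :: "'k::field coord_ring ^ 4"
  assumes "\<And>i. homogeneous 1 (g $ i)" "g $ k \<noteq> 0"
  shows "{f. poly_subst f g = 0} \<in> Proj"
  by (rule ProjI[of _ k])
    (use assms in \<open>auto simp: rhom.zero[OF rhom_poly_subst] rhom.add[OF rhom_poly_subst]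
       rhom.mult[OF rhom_poly_subst] simp flip: hcomp_poly_subst\<close>)

section \<open>The Zariski topology\<close>

lemma zeros_Un: "zeros (A \<union> B) = zeros A \<inter> zeros B"
  by (auto simp: zeros_def)

lemma zeros_subset_Proj: "zeros B \<subseteq> Proj"
  by (auto simp: zeros_def)

lemma zeros_UNIV: "zeros (UNIV :: 'k::field coord_ring set) = {}"
proof -
  have "(1 :: 'k coord_ring) \<notin> P" if "P \<in> Proj" for P
    using that proj_point.one[of P] by (simp add: proj_point_def)
  then show "(zeros UNIV :: 'k coord_ring set set) = {}" by (auto simp: zeros_def)
qed

lemma openin_zariski: "openin zariski U \<longleftrightarrow> (\<exists>B. U = Proj - zeros B)"
  unfolding zariski_def by (simp add: topology_inverse' istopology_zariski)

lemma topspace_zariski: "topspace zariski = Proj"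
  unfolding topspace_def openin_zariski using zeros_UNIV by blast

lemma closedin_zariski: "closedin zariski Z \<longleftrightarrow> (\<exists>B. Z = zeros B)"
  unfolding closedin_def topspace_zariski openin_zariski using zeros_subset_Proj by blast

lemma topspace_scheme_space: "topspace (scheme_space A) = zeros A"
  using zeros_subset_Proj by (auto simp: scheme_space_def topspace_zariski)

lemma closedin_scheme_space: "closedin (scheme_space A) Z \<longleftrightarrow> (\<exists>B. Z = zeros B) \<and> Z \<subseteq> zeros A"
proof -
  have "closedin zariski (zeros A)" by (auto simp: closedin_zariski)
  then show ?thesis
    by (simp add: scheme_space_def closedin_closed_subtopology closedin_zariski)
qed

lemma closedin_zeros_Un: "closedin (scheme_space A) (zeros (A \<union> B))"
  unfolding closedin_scheme_space by (metis inf_le1 zeros_Un)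

lemma openin_scheme_space: "openin (scheme_space A) (zeros A - zeros B)"
proof -
  have "zeros A - zeros B = zeros A - zeros (A \<union> B)" by (auto simp: zeros_Un)
  then show ?thesis
    by (metis closedin_zeros_Un openin_diff openin_topspace topspace_scheme_space)
qed

lemma scheme_space_subset:
  "zeros B \<subseteq> zeros A \<Longrightarrow> subtopology (scheme_space A) (zeros B) = scheme_space B"
  by (simp add: scheme_space_def subtopology_subtopology inf.absorb2)

text \<open>The prime \<open>Q\<close> is a generic point of \<open>zeros Q\<close>: a closed set
  containing \<open>Q\<close> contains all of \<open>zeros Q\<close>, so one of any two covering
  closed sets does.\<close>

lemma irreducible_zeros:
  assumes "Q \<in> Proj" "A \<subseteq> Q"
  shows "irreducible_in (scheme_space A) (zeros Q)"
proof -
  have Q: "Q \<in> zeros Q" using assms by (simp add: zeros_def)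
  have sub: "zeros Q \<subseteq> C" if "closedin (scheme_space A) C" "Q \<in> C" for C
    using that unfolding closedin_scheme_space by (auto simp: zeros_def)
  show ?thesis
    unfolding irreducible_in_def topspace_scheme_space
  proof (intro conjI allI impI)
    show "zeros Q \<subseteq> zeros A" using assms by (auto simp: zeros_def)
    show "zeros Q \<noteq> {}" using Q by auto
    show "zeros Q \<subseteq> C \<or> zeros Q \<subseteq> D"
      if "closedin (scheme_space A) C" "closedin (scheme_space A) D" "zeros Q \<subseteq> C \<union> D" for C D
      using that sub Q by blast
  qed
qed

text \<open>The vanishing ideal of an irreducible set is prime: if f g vanishes on \<open>Z\<close>,
  the zero loci of f and g cover \<open>Z\<close>, so one of them contains it.\<close>

lemma irreducible_imp_Inter_in_Proj:
  fixes Z :: "'k::field coord_ring set set"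
  assumes "irreducible_in (scheme_space A) Z"
  shows "\<Inter>Z \<in> Proj"
proof -
  have Z: "Z \<subseteq> zeros A" "Z \<noteq> {}" and irr: "\<And>C D. closedin (scheme_space A) C \<Longrightarrow>
      closedin (scheme_space A) D \<Longrightarrow> Z \<subseteq> C \<union> D \<Longrightarrow> Z \<subseteq> C \<or> Z \<subseteq> D"
    using assms by (auto simp: irreducible_in_def topspace_scheme_space)
  have pt: "proj_point P" if "P \<in> Z" for P
    using that Z by (auto simp: proj_point_def zeros_def)
  obtain P where "P \<in> Z" using Z by auto
  then obtain k where k: "Xv k \<notin> P" using proj_point.ex_Xv[OF pt] by blast
  show ?thesis
  proof (rule ProjI[of _ k])
    fix f g assume fg: "f * g \<in> \<Inter>Z"
    have "Z \<subseteq> zeros (A \<union> {f}) \<union> zeros (A \<union> {g})"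
      using fg Z pt by (auto simp: zeros_def proj_point.mult_iff)
    from irr[OF closedin_zeros_Un closedin_zeros_Un this] show "f \<in> \<Inter>Z \<or> g \<in> \<Inter>Z"
      by (auto simp: zeros_def)
  next
    show "0 \<in> \<Inter>Z" using pt proj_point.zero by blast
    show "f + g \<in> \<Inter>Z" if "f \<in> \<Inter>Z" "g \<in> \<Inter>Z" for f g
      using that pt proj_point.add by blast
    show "g * f \<in> \<Inter>Z" if "f \<in> \<Inter>Z" for f g
      using that pt proj_point.mult_left by blast
    show "hcomp d f \<in> \<Inter>Z" if "f \<in> \<Inter>Z" for f d
      using that pt proj_point.hcomp by blast
    show "Xv k \<notin> \<Inter>Z" using k \<open>P \<in> Z\<close> by blast
  qed
qed

lemma zeros_Inter: "zeros (\<Inter>(zeros B)) = zeros B"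
  by (auto simp: zeros_def)

text \<open>For irreducible \<open>W\<close> the prime \<open>\<Inter>W\<close> is itself a point of
  the scheme, so it lies on some \<open>zeros (Q e)\<close>; every point of \<open>W\<close>
  contains that prime and therefore lies there too. Incomparability makes these pieces
  maximal.\<close>

lemma irreducible_components_scheme_space:
  assumes cover: "zeros A = (\<Union>e. zeros (Q e))" and Q: "\<And>e. Q e \<in> Proj"
    and incomparable: "\<And>e e'. Q e \<subseteq> Q e' \<Longrightarrow> e = e'"
  shows "irreducible_components (scheme_space A) = range (\<lambda>e. zeros (Q e))"
proof -
  have "Q e \<in> zeros A" for e using cover Q by (auto simp: zeros_def)
  then have irr: "irreducible_in (scheme_space A) (zeros (Q e))" for e
    by (intro irreducible_zeros Q) (auto simp: zeros_def)
  have sub: "\<exists>e. W \<subseteq> zeros (Q e)" if W: "irreducible_in (scheme_space A) W" for W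
  proof -
    have "W \<subseteq> zeros A" using W by (simp add: irreducible_in_def topspace_scheme_space)
    then have "\<Inter>W \<in> zeros A"
      using irreducible_imp_Inter_in_Proj[OF W] by (auto simp: zeros_def)
    then obtain e where "\<Inter>W \<in> zeros (Q e)" using cover by blast
    with \<open>W \<subseteq> zeros A\<close> have "W \<subseteq> zeros (Q e)" by (auto simp: zeros_def)
    then show ?thesis ..
  qed
  have max: "zeros (Q e) = W" if W: "irreducible_in (scheme_space A) W" and "zeros (Q e) \<subseteq> W" for e W
  proof -
    obtain e' where e': "W \<subseteq> zeros (Q e')" using sub[OF W] ..
    have "Q e \<in> zeros (Q e')" using that e' Q by (auto simp: zeros_def)
    then have "e' = e" by (intro incomparable) (auto simp: zeros_def)
    then show ?thesis using that e' by auto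
  qed
  show ?thesis
  proof (intro equalityI subsetI)
    fix Z assume "Z \<in> irreducible_components (scheme_space A)"
    then have Z: "irreducible_in (scheme_space A) Z"
      and max: "\<And>W. irreducible_in (scheme_space A) W \<Longrightarrow> Z \<subseteq> W \<Longrightarrow> W = Z"
      by (auto simp: irreducible_components_def)
    obtain e where "Z \<subseteq> zeros (Q e)" using sub[OF Z] ..
    then have "zeros (Q e) = Z" by (intro max irr)
    then show "Z \<in> range (\<lambda>e. zeros (Q e))" by auto
  next
    fix Z assume "Z \<in> range (\<lambda>e. zeros (Q e))"
    then show "Z \<in> irreducible_components (scheme_space A)"
      unfolding irreducible_components_def using irr max by auto
  qed
qed

text \<open>Intersections turn a chain of irreducible closed sets into a descending chain of primes
  above the generic point \<open>Q\<close>. The prime \<open>Q'\<close> provides a chain of length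
  one, and \<open>max\<close> says that a prime strictly above \<open>Q\<close> is maximal in
  \<open>Proj\<close>, which rules out length two.\<close>

lemma krull_dim_scheme_space_eq_1:
  assumes Q: "Q \<in> Proj" "F \<subseteq> Q" "\<And>P. P \<in> zeros F \<Longrightarrow> Q \<subseteq> P"
    and Q': "Q' \<in> Proj" "Q \<subset> Q'"
    and max: "\<And>P P'. P \<in> Proj \<Longrightarrow> P' \<in> Proj \<Longrightarrow> Q \<subset> P \<Longrightarrow> P \<subseteq> P' \<Longrightarrow> P' = P"
  shows "krull_dim (scheme_space F) = 1"
proof -
  define T where "T = scheme_space F"
  define chain where "chain n Z \<longleftrightarrow> (\<forall>i\<le>n. closedin T (Z i) \<and> irreducible_in T (Z i)) \<and>
      (\<forall>i<n. Z i \<subset> Z (Suc i))" for n and Z :: "nat \<Rightarrow> _"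
  have le: "n \<le> 1" if "chain n Z" for n Z
  proof (rule ccontr)
    assume "\<not> n \<le> 1"
    then have n: "0 \<le> n" "1 \<le> n" "2 \<le> n" "0 < n" "1 < n" by auto
    have prime: "\<Inter>(Z i) \<in> Proj" "zeros (\<Inter>(Z i)) = Z i" "Z i \<subseteq> zeros F" if "i \<le> n" for i
    proof -
      have "closedin (scheme_space F) (Z i)" and irr: "irreducible_in (scheme_space F) (Z i)"
        using \<open>chain n Z\<close> that by (simp_all add: chain_def T_def)
      then obtain B where "Z i = zeros B" "Z i \<subseteq> zeros F"
        unfolding closedin_scheme_space by blast
      then show "zeros (\<Inter>(Z i)) = Z i" "Z i \<subseteq> zeros F"
        by (simp_all only: zeros_Inter)
      show "\<Inter>(Z i) \<in> Proj" by (rule irreducible_imp_Inter_in_Proj[OF irr])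
    qed
    have "Z i \<subset> Z (Suc i)" if "i < n" for i
      using \<open>chain n Z\<close> that by (simp add: chain_def)
    from this[OF n(4)] this[OF n(5)] have "Z 0 \<subset> Z 1" "Z 1 \<subset> Z 2"
      by (simp_all add: numeral_2_eq_2)
    then have "\<Inter>(Z 2) \<subseteq> \<Inter>(Z 1)" "\<Inter>(Z 1) \<subseteq> \<Inter>(Z 0)" by (intro Inter_anti_mono; simp add: psubset_imp_subset)+
    moreover have "\<Inter>(Z 2) \<noteq> \<Inter>(Z 1)" "\<Inter>(Z 1) \<noteq> \<Inter>(Z 0)"
      using \<open>Z 0 \<subset> Z 1\<close> \<open>Z 1 \<subset> Z 2\<close> prime(2)[OF n(1)] prime(2)[OF n(2)] prime(2)[OF n(3)]
      by (metis less_irrefl)+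
    moreover have "Q \<subseteq> \<Inter>(Z 2)" using prime(3)[OF n(3)] Q(3) by blast
    \<comment> \<open>In Q \<subseteq> \<Inter>(Z 2) \<subset> \<Inter>(Z 1) \<subset> \<Inter>(Z 0)
      the middle prime is strictly above \<open>Q\<close> but not maximal.\<close>
    ultimately show False
      using max[OF prime(1)[OF n(2)] prime(1)[OF n(1)]] by (metis order.trans psubsetI subset_antisym)
  qed
  have "irreducible_in T (zeros Q')" "irreducible_in T (zeros Q)"
    unfolding T_def by (intro irreducible_zeros; use Q Q' in auto)+
  moreover have "zeros Q' \<subset> zeros Q" "zeros Q \<subseteq> zeros F" "zeros Q' \<subseteq> zeros F"
    using Q Q' by (auto simp: zeros_def)
  ultimately have "chain 1 (\<lambda>i. if i = 0 then zeros Q' else zeros Q)"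
    by (auto simp: chain_def T_def closedin_scheme_space)
  then have "1 \<in> {n. \<exists>Z. chain n Z}" by auto
  then have "(SUP n\<in>{n. \<exists>Z. chain n Z}. enat n) = enat 1"
    by (intro antisym SUP_least SUP_upper) (use le in auto)
  then show ?thesis
    by (simp add: krull_dim_def chain_def T_def one_enat_def)
qed

section \<open>Matrices with a one-dimensional kernel\<close>

text \<open>Linear algebra over the fraction field, to which matrix and kernel vector are carried by
  an injective homomorphism. The domain needed is the polynomial ring, where the generic point of a
  line has its coordinates.\<close>

lemma det_eq_0_if_kernel:
  fixes A :: "'a::idom ^ 'n ^ 'n"
  assumes "A *v w = 0" "w \<noteq> 0"
  shows "det A = 0"
proof -
  define h where "h a = Fract a 1" for a :: 'a
  interpret h: rhom h
    by unfold_locales (simp_all add: h_def One_fract_def)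
  have inj: "h a = 0 \<longleftrightarrow> a = 0" for a
    by (simp add: h_def Zero_fract_def eq_fract)
  let ?A = "\<chi> i j. h (A $ i $ j)" and ?w = "\<chi> i. h (w $ i)"
  have "?A *v ?w = 0"
    using assms(1) by (simp add: vec_eq_iff matrix_vector_mult_def h.zero flip: h.mult h.sum)
  moreover have "?w \<noteq> 0"
    using assms(2) by (simp add: vec_eq_iff inj)
  ultimately have "\<not> invertible ?A"
    unfolding invertible_left_inverse matrix_left_invertible_ker by blast
  then have "det ?A = 0" by (simp add: invertible_det_nz)
  then show ?thesis by (simp add: inj flip: h.det)
qed

text \<open>Adjoin to \<open>A\<close> the unit row at a position \<open>k\<close> where
  \<open>w\<close> is nonzero. The enlarged matrix \<open>B\<close>, whose extra row has index
  \<open>None\<close>, has trivial kernel and thus full rank, so \<open>A\<close> lacks at most one;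
  full rank of \<open>A\<close> itself would contradict \<open>w\<close>.\<close>

lemma rank_one_dim_kernel:
  fixes A :: "'a::field ^ 'n ^ 'm"
  assumes ker: "{x. A *v x = 0} = vec.span {w}" and w: "w \<noteq> 0"
  shows "Suc (rank A) = CARD('n)"
proof -
  obtain k where k: "w $ k \<noteq> 0" using w by (auto simp: vec_eq_iff)
  define B :: "'a ^ 'n ^ ('m option)" where "B = (\<chi> r. case r of None \<Rightarrow> axis k 1 | Some r \<Rightarrow> A $ r)"
  have rows: "rows B = insert (axis k 1) (rows A)"
  proof -
    have "rows A = range (\<lambda>r. A $ r)" "rows B = (\<lambda>r. B $ r) ` insert None (range Some)"
      by (auto simp: rows_def row_def simp flip: UNIV_option_conv)
    then show ?thesis by (simp add: B_def image_image)
  qed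
  have "x = 0" if "B *v x = 0" for x
  proof -
    have Bx: "(\<Sum>j\<in>UNIV. B $ r $ j * x $ j) = 0" for r
      using that by (simp add: matrix_vector_mult_def vec_eq_iff)
    have "A *v x = 0"
      using Bx[of "Some r" for r] by (simp add: B_def matrix_vector_mult_def vec_eq_iff)
    then obtain c where c: "x = c *s w"
      using ker by (auto simp: vec.span_singleton)
    have "x $ k = 0"
      using Bx[of None] by (simp add: B_def axis_def if_distrib[of "\<lambda>a. a * _"] cong: if_cong)
    then show ?thesis using c k by simp
  qed
  then have "vec.span (rows B) = UNIV"
    by (simp add: matrix_left_invertible_ker flip: matrix_left_invertible_span_rows_gen)
  then have "CARD('n) = vec.dim (rows B)"
    by (metis vec.dim_span vec.dim_UNIV vec_dim_card)
  also have "\<dots> \<le> Suc (rank A)"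
    by (simp add: rows row_rank_def_gen vec.dim_insert)
  finally have "CARD('n) \<le> Suc (rank A)" .
  moreover have "rank A < CARD('n)"
  proof (rule ccontr)
    assume "\<not> rank A < CARD('n)"
    moreover have "rank A \<le> CARD('n)"
      by (metis row_rank_def_gen vec.dim_subset subset_UNIV vec_dim_card)
    ultimately have "vec.dim (rows A) = CARD('n)" by (simp add: row_rank_def_gen)
    then have "vec.span (rows A) = UNIV"
      using vec.dim_eq_span[of "rows A" UNIV] by (simp add: card_cart_basis)
    then have "\<forall>x. A *v x = 0 \<longrightarrow> x = 0"
      by (simp add: matrix_left_invertible_ker flip: matrix_left_invertible_span_rows_gen)
    moreover have "A *v w = 0" using ker vec.span_base[of w "{w}"] by auto
    ultimately show False using w by blast
  qed
  ultimately show ?thesis by simp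
qed

section \<open>Six lines\<close>

datatype line = L12 | L34 | L13 | L24 | L23 | L14

text \<open>Parametrizations of the six lines. The coefficient ring is arbitrary, so the parameters
  can be scalars or polynomials.\<close>

fun pt :: "line \<Rightarrow> 'a \<Rightarrow> 'a \<Rightarrow> 'a::comm_ring_1 ^ 4" where
  "pt L12 a b = vector [0, 0, a, b]"
| "pt L34 a b = vector [a, b, 0, 0]"
| "pt L13 a b = vector [a, a, b, b]"
| "pt L24 a b = vector [a, - a, b, - b]"
| "pt L23 a b = vector [a, - a, b, b]"
| "pt L14 a b = vector [a, a, b, - b]"

text \<open>With \<open>coord2\<close>, a choice of two coordinates that recover the parameters of a
  point on the line.\<close>

fun coord1 :: "line \<Rightarrow> 'a ^ 4 \<Rightarrow> 'a" where
  "coord1 L12 x = x $ 3" | "coord1 L34 x = x $ 1" | "coord1 L13 x = x $ 1"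
| "coord1 L24 x = x $ 1" | "coord1 L23 x = x $ 1" | "coord1 L14 x = x $ 1"

fun coord2 :: "line \<Rightarrow> 'a ^ 4 \<Rightarrow> 'a" where
  "coord2 L12 x = x $ 4" | "coord2 L34 x = x $ 2" | "coord2 L13 x = x $ 3"
| "coord2 L24 x = x $ 3" | "coord2 L23 x = x $ 3" | "coord2 L14 x = x $ 3"

fun eqs :: "line \<Rightarrow> 'a ^ 4 \<Rightarrow> 'a::comm_ring_1 set" where
  "eqs L12 x = {x $ 1, x $ 2}"
| "eqs L34 x = {x $ 3, x $ 4}"
| "eqs L13 x = {x $ 1 - x $ 2, x $ 3 - x $ 4}"
| "eqs L24 x = {x $ 1 + x $ 2, x $ 3 + x $ 4}"
| "eqs L23 x = {x $ 1 + x $ 2, x $ 3 - x $ 4}"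
| "eqs L14 x = {x $ 1 - x $ 2, x $ 3 + x $ 4}"

text \<open>Together with \<open>sg\<close> this encodes tau: with the first parameter kept,
  \<open>pt e a b\<close> goes to \<open>pt (opp e) a (sg e b)\<close>. Four edges of the
  tetrahedron are exchanged with their opposite edges, but \<open>L12\<close> and
  \<open>L34\<close>, although opposite to each other, are each mapped to themselves.\<close>

fun opp :: "line \<Rightarrow> line" where
  "opp L12 = L12" | "opp L34 = L34" | "opp L13 = L24" | "opp L24 = L13" | "opp L23 = L14" | "opp L14 = L23"

fun sg :: "line \<Rightarrow> 'a::comm_ring_1 \<Rightarrow> 'a" where
  "sg L12 b = - b" | "sg L34 b = - b" | "sg L13 b = b" | "sg L24 b = b" | "sg L23 b = - b" | "sg L14 b = - b"

definition hyp :: "'a::comm_ring_1 ^ 4 \<Rightarrow> 'a ^ 4"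
  where "hyp x = vector [x $ 1 - x $ 2, x $ 1 + x $ 2, x $ 3 - x $ 4, x $ 3 + x $ 4]"

text \<open>
  The \<open>v\<close>-th row agrees with \<open>\<tau>\<close> on the three lines that are not contained in the plane
  \<open>hyp x $ v = 0\<close>. These lines meet in one point and span the space, which determines the
  linear map up to a scalar.
\<close>

definition chart :: "'a::comm_ring_1 ^ 4 \<Rightarrow> 'a ^ 4 ^ 4"
  where "chart x = vector
    [vector [x $ 1, - x $ 2, - x $ 4, x $ 3],
     vector [x $ 1, - x $ 2, x $ 4, - x $ 3],
     vector [- x $ 2, x $ 1, x $ 3, - x $ 4],
     vector [x $ 2, - x $ 1, x $ 3, - x $ 4]]"

definition rel_mat :: "'a::comm_ring_1 ^ 4 \<Rightarrow> 'a ^ 4 ^ 6"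
  where "rel_mat x = vector
    [vector [x $ 2, x $ 1, 0, 0],
     vector [0, x $ 4, x $ 1, 0],
     vector [0, - x $ 3, 0, x $ 1],
     vector [- x $ 4, 0, x $ 2, 0],
     vector [x $ 3, 0, 0, x $ 2],
     vector [0, 0, x $ 4, x $ 3]]"

lemma all_4: "P 1 \<Longrightarrow> P 2 \<Longrightarrow> P 3 \<Longrightarrow> P 4 \<Longrightarrow> P (k::4)"
  using forall_4[of P] by blast

lemma all_6: "P 1 \<Longrightarrow> P 2 \<Longrightarrow> P 3 \<Longrightarrow> P 4 \<Longrightarrow> P 5 \<Longrightarrow> P 6 \<Longrightarrow> P (k::6)"
  using forall_6[of P] by blast

lemma coord1_pt [simp]: "coord1 e (pt e a b) = a" and coord2_pt [simp]: "coord2 e (pt e a b) = b"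
  by (cases e; simp)+

lemma opp_opp [simp]: "opp (opp e) = e"
  by (cases e) simp_all

lemma sg_sg [simp]: "sg (opp e) (sg e b) = b" "sg e (sg (opp e) b) = b"
  by (cases e; simp)+

lemma scale_pt: "c *s pt e a b = pt e (c * a) (c * b)"
  by (cases e) (simp_all add: vec_eq_iff forall_4)

lemma pt_eq_0_iff: "pt e a b = 0 \<longleftrightarrow> a = 0 \<and> b = 0"
  by (cases e) (auto simp: vec_eq_iff forall_4)

lemma rel_mat_mult_pt: "rel_mat (pt e a b) *v pt (opp e) a (sg e b) = 0"
  by (cases e) (simp_all add: rel_mat_def vec_eq_iff forall_6 matrix_vector_mult_def sum_4 algebra_simps)

lemma kernel_rel_mat_pt:
  fixes a b :: "'a::field"
  assumes "(a, b) \<noteq> (0, 0)"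
  shows "{x. rel_mat (pt e a b) *v x = 0} = vec.span {pt (opp e) a (sg e b)}"
proof (intro equalityI subsetI)
  fix x assume "x \<in> {x. rel_mat (pt e a b) *v x = 0}"
  then have x: "rel_mat (pt e a b) *v x = 0" by simp
  let ?t = "pt (opp e) a (sg e b)"
  \<comment> \<open>Proportionality of \<open>x\<close> and \<open>?t\<close> with denominators
    cleared: each parameter of \<open>?t\<close> times \<open>x\<close> is a multiple of
    \<open>?t\<close>. It then suffices to divide by a nonzero parameter.\<close>
  have ab: "a * x $ i = coord1 (opp e) x * ?t $ i \<and> sg e b * x $ i = coord2 (opp e) x * ?t $ i" for i
    by (insert x, rule all_4[of _ i]; cases e;
      auto simp: rel_mat_def vec_eq_iff forall_6 matrix_vector_mult_def sum_4 add_eq_0_iff mult.commute;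
      metis minus_minus mult_left_cancel)
  have "sg e b \<noteq> 0" if "b \<noteq> 0" using that by (cases e) simp_all
  with assms have "a \<noteq> 0 \<or> sg e b \<noteq> 0" by auto
  then have "x = (coord1 (opp e) x / a) *s ?t \<or> x = (coord2 (opp e) x / sg e b) *s ?t"
    using ab by (auto simp: vec_eq_iff field_simps)
  then show "x \<in> vec.span {pt (opp e) a (sg e b)}" by (auto simp: vec.span_singleton)
next
  fix x assume "x \<in> vec.span {pt (opp e) a (sg e b)}"
  then obtain c where "x = c *s pt (opp e) a (sg e b)" by (auto simp: vec.span_singleton)
  then show "x \<in> {x. rel_mat (pt e a b) *v x = 0}"
    by (simp add: rel_mat_mult_pt vec.scale)
qed

text \<open>The hypothesis excludes the lines inside the plane; on the other three the chart is tau
  up to sign. Recording the sign as \<open>c * c = 1\<close> keeps it a unit over any ring without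
  naming the line.\<close>

lemma chart_pt:
  assumes "hyp (pt e a b) $ k \<noteq> 0"
  shows "\<exists>c. c * c = 1 \<and> chart (pt e a b) $ k = c *s pt (opp e) a (sg e b)"
proof -
  have "hyp (pt e a b) $ k \<noteq> 0 \<longrightarrow> chart (pt e a b) $ k = pt (opp e) a (sg e b) \<or>
      chart (pt e a b) $ k = - pt (opp e) a (sg e b)"
    by (rule all_4[of _ k]; cases e; simp add: hyp_def chart_def vec_eq_iff forall_4)
  then have "chart (pt e a b) $ k = 1 *s pt (opp e) a (sg e b) \<or>
      chart (pt e a b) $ k = (- 1) *s pt (opp e) a (sg e b)"
    using assms by (auto simp: vec_eq_iff)
  then show ?thesis
    by (elim disjE) (intro exI conjI; assumption?; simp)+
qed

lemma hyp_scale: "hyp (c *s x) = c *s hyp x"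
  by (simp add: hyp_def vec_eq_iff forall_4 algebra_simps)

lemma chart_scale: "chart (c *s x) $ k = c *s (chart x $ k)"
  by (rule all_4[of _ k]; simp add: chart_def vec_eq_iff forall_4)

lemma rhom_hyp: "rhom h \<Longrightarrow> h (hyp x $ k) = hyp (\<chi> i. h (x $ i)) $ k"
  by (rule all_4[of _ k]; simp add: hyp_def rhom.simps)

lemma rhom_chart: "rhom h \<Longrightarrow> h (chart x $ k $ i) = chart (\<chi> i. h (x $ i)) $ k $ i"
  by (rule all_4[of _ k]; rule all_4[of _ i]; simp add: chart_def rhom.simps)

lemma rhom_pt: "rhom h \<Longrightarrow> h (pt e a b $ k) = pt e (h a) (h b) $ k"
  by (rule all_4[of _ k]; cases e; simp add: rhom.simps)

lemma rhom_rel_mat: "rhom h \<Longrightarrow> h (rel_mat x $ r $ j) = rel_mat (\<chi> i. h (x $ i)) $ r $ j"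
  by (rule all_6[of _ r]; rule all_4[of _ j]; simp add: rel_mat_def rhom.simps)

lemma rhom_eqs: "rhom h \<Longrightarrow> h ` eqs e x = eqs e (\<chi> i. h (x $ i))"
  by (cases e; simp add: rhom.simps)

lemma eqs_pt: "eqs e (pt e a b) = {0}"
  by (cases e) simp_all

lemma pt_if_eqs: "eqs e x \<subseteq> {0} \<Longrightarrow> x = pt e (coord1 e x) (coord2 e x)"
  by (cases e) (auto simp: vec_eq_iff forall_4 algebra_simps eq_neg_iff_add_eq_0)

lemma relation_matrix_relations_R: "relation_matrix relations_R = rel_mat Xvec"
  by (simp add: vec_eq_iff forall_6 forall_4 relation_matrix_def rel_mat_def relations_R_def
      sum_4 gen_def mult_single plus_ncword_def lookup_add lookup_minus lookup_single when_def Xv_def single_uminus)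

lemma matrix_at_relations_R: "matrix_at relations_R v = rel_mat v"
  by (simp add: matrix_at_def relation_matrix_relations_R rhom_rel_mat[OF rhom_poly_at] vec_eq_iff)

section \<open>The ideals of the six lines\<close>

abbreviation lpt :: "line \<Rightarrow> 'k::field coord_ring ^ 4"
  where "lpt e \<equiv> pt e (coord1 e Xvec) (coord2 e Xvec)"

text \<open>The substitution \<open>lpt e\<close> is the generic point of the line: it restricts
  polynomials to the line and keeps two variables as parameters. Taking the kernel of this
  restriction, rather than the ideal generated by two linear forms, gives primality at once.\<close>

definition line_ideal :: "line \<Rightarrow> 'k::field coord_ring set"
  where "line_ideal e = {f. poly_subst f (lpt e) = 0}"

lemma rhom_coord1: "h (coord1 e x) = coord1 e (\<chi> i. h (x $ i))" and rhom_coord2: "h (coord2 e x) = coord2 e (\<chi> i. h (x $ i))"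
  by (cases e; simp)+

lemma poly_subst_pt_eq_0:
  assumes "f \<in> line_ideal e"
  shows "poly_subst f (pt e a b) = 0"
proof -
  have "poly_subst (poly_subst f (lpt e)) (pt e a b) = poly_subst f (pt e a b)"
    by (simp add: poly_subst_poly_subst rhom_pt[OF rhom_poly_subst] rhom_coord1[of "\<lambda>f. poly_subst f _"]
        rhom_coord2[of "\<lambda>f. poly_subst f _"])
  then show ?thesis
    using assms by (simp add: line_ideal_def rhom.zero[OF rhom_poly_subst])
qed

lemma poly_at_pt_eq_0:
  assumes "f \<in> line_ideal e"
  shows "poly_at f (pt e a b) = 0"
proof -
  have "poly_at (poly_subst f (lpt e)) (pt e a b) = poly_at f (pt e a b)"
    by (simp add: poly_at_poly_subst rhom_pt[OF rhom_poly_at] rhom_coord1[of "\<lambda>f. poly_at f _"]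
        rhom_coord2[of "\<lambda>f. poly_at f _"])
  then show ?thesis
    using assms by (simp add: line_ideal_def rhom.zero[OF rhom_poly_at])
qed

lemma Xv_nonzero [simp]: "Xv i \<noteq> (0 :: 'k::field coord_ring)"
proof
  assume "Xv i = (0 :: 'k coord_ring)"
  then have "poly_at (Xv i) ((\<chi> i. 1) :: 'k ^ 4) = 0" by (simp add: rhom.zero[OF rhom_poly_at])
  then show False by simp
qed

lemma homogeneous_pt:
  assumes "homogeneous d a" "homogeneous d b"
  shows "homogeneous d (pt e a b $ i)"
  by (rule all_4[of _ i]; cases e; simp add: assms homogeneous_uminus)

lemma line_ideal_in_Proj: "(line_ideal e :: 'k::field coord_ring set) \<in> Proj"
proof -
  have "homogeneous 1 (coord1 e Xvec :: 'k coord_ring)" "homogeneous 1 (coord2 e Xvec :: 'k coord_ring)"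
    by (cases e; simp add: homogeneous_Xv[simplified])+
  moreover obtain k where "lpt e $ k \<noteq> (0 :: 'k coord_ring)"
    by (cases e) (auto intro: that[of 1] that[of 3])
  ultimately show ?thesis
    unfolding line_ideal_def by (intro kernel_in_Proj[of _ k] homogeneous_pt)
qed

lemma eqs_subset_line_ideal: "eqs e Xvec \<subseteq> line_ideal e"
proof
  fix f assume "f \<in> eqs e Xvec"
  then have "poly_subst f (lpt e) \<in> (\<lambda>f. poly_subst f (lpt e)) ` eqs e Xvec" by blast
  then show "f \<in> line_ideal e"
    by (simp add: rhom_eqs[OF rhom_poly_subst] eqs_pt line_ideal_def)
qed

context proj_point
begin

lemma Xv_cong_lpt:
  assumes "eqs e Xvec \<subseteq> P"
  shows "Xv i - lpt e $ i \<in> P"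
  by (insert assms, rule all_4[of _ i]; cases e;
    auto simp: zero uminus add.commute dest: uminus)

text \<open>Modulo a prime containing the two equations every variable is congruent to its
  restriction to the line, hence so is every polynomial. This replaces the statement that the
  equations generate the line ideal.\<close>

lemma line_ideal_subset:
  assumes "eqs e Xvec \<subseteq> P"
  shows "line_ideal e \<subseteq> P"
proof
  fix f :: "'k coord_ring" assume "f \<in> line_ideal e"
  moreover have "poly_subst f Xvec - poly_subst f (lpt e) \<in> P"
    by (rule cong_poly_subst) (use Xv_cong_lpt[OF assms] in simp)
  ultimately show "f \<in> P" by (simp add: line_ideal_def)
qed

end

lemma zeros_eqs: "zeros (eqs e Xvec) = zeros (line_ideal e)"
  using proj_point.line_ideal_subset eqs_subset_line_ideal
  by (fastforce simp: zeros_def proj_point_def)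

lemma line_ideal_incomparable:
  assumes "line_ideal e \<subseteq> (line_ideal e' :: 'k::{field, field_char_0} coord_ring set)"
  shows "e = e'"
proof -
  \<comment> \<open>Parameters 1 and 2 give a point of the line \<open>e'\<close> that is no vertex
    of the tetrahedron: on two edges the vertices are where the parameters are equal or opposite, on
    the other four where one of them is zero.\<close>
  have "poly_at f (pt e' 1 2 :: 'k ^ 4) = 0" if "f \<in> eqs e Xvec" for f
    using that assms eqs_subset_line_ideal poly_at_pt_eq_0 by blast
  then have "(\<lambda>f. poly_at f (pt e' 1 2 :: 'k ^ 4)) ` eqs e Xvec \<subseteq> {0}" by blast
  then have "eqs e (pt e' 1 2 :: 'k ^ 4) \<subseteq> {0}"
    by (simp add: rhom_eqs[OF rhom_poly_at])
  then show "e = e'" by (cases e; cases e') simp_all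
qed

section \<open>The intersection of the line ideals\<close>

text \<open>Setting the variables in \<open>S\<close> to zero deletes the monomials that involve
  \<open>S\<close> and leaves the others alone. So a polynomial vanishing on this subspace has no
  monomial free of \<open>S\<close>.\<close>

lemma lookup_poly_subst_coordinate_subspace:
  assumes "\<And>l. l \<in> S \<Longrightarrow> Poly_Mapping.lookup m l = 0"
  shows "Poly_Mapping.lookup (poly_subst f (\<chi> l. if l \<in> S then 0 else Xv l)) m = Poly_Mapping.lookup f m"
proof -
  define g :: "'a::field coord_ring ^ 4" where "g = (\<chi> l. if l \<in> S then 0 else Xv l)"
  have g: "eval_mon g n = (if \<forall>l\<in>S. Poly_Mapping.lookup n l = 0 then Poly_Mapping.single n 1 else 0)" for n
  proof (cases "\<forall>l\<in>S. Poly_Mapping.lookup n l = 0")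
    case True
    then have "eval_mon g n = eval_mon Xvec n"
      unfolding eval_mon_def g_def by (intro prod.cong) auto
    then show ?thesis using True by (simp add: eval_mon_Xvec)
  next
    case False
    then show ?thesis
      unfolding eval_mon_def g_def by (auto intro!: prod_zero)
  qed
  have "Poly_Mapping.lookup (poly_subst f g) m = (\<Sum>n\<in>Poly_Mapping.keys f.
      if n = m then Poly_Mapping.lookup f m else 0)"
    unfolding poly_subst_eq_ev ev_def lookup_sum
    by (rule sum.cong) (auto simp: g mult_single lookup_single when_def assms)
  then show ?thesis
    by (simp add: g_def sum.delta in_keys_iff)
qed

lemma eval_mon_factor:
  assumes "Poly_Mapping.lookup m i \<noteq> 0" "Poly_Mapping.lookup m j \<noteq> 0" "Poly_Mapping.lookup m k \<noteq> 0"
    and "i \<noteq> j" "i \<noteq> k" "j \<noteq> k"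
  shows "\<exists>r. eval_mon x m = r * (x $ i * x $ j * x $ k)"
proof -
  let ?n = "Poly_Mapping.single i 1 + Poly_Mapping.single j 1 + Poly_Mapping.single k 1"
  have "m = (m - ?n) + ?n"
    by (rule poly_mapping_eqI) (use assms in \<open>auto simp: lookup_add lookup_minus lookup_single when_def\<close>)
  then have "eval_mon x m = eval_mon x (m - ?n) * eval_mon x ?n"
    by (metis eval_mon_add)
  then show ?thesis by (auto simp: eval_mon_add)
qed

text \<open>The vector is the point whose tetrahedral coordinates \<open>hyp\<close> are 2 y, so two
  vanishing entries of y put it on an edge.\<close>

lemma tetrahedron_edge:
  fixes y :: "'a::comm_ring_1 ^ 4"
  assumes "(i, j) \<in> {(1, 2), (3, 4), (1, 3), (2, 4), (2, 3), (1, 4)}" "y $ i = 0" "y $ j = 0"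
  obtains e a b where "vector [y $ 1 + y $ 2, y $ 2 - y $ 1, y $ 3 + y $ 4, y $ 4 - y $ 3] = pt e a b"
proof -
  let ?x = "vector [y $ 1 + y $ 2, y $ 2 - y $ 1, y $ 3 + y $ 4, y $ 4 - y $ 3] :: 'a ^ 4"
  have "?x = pt L12 (y $ 3 + y $ 4) (y $ 4 - y $ 3) \<or> ?x = pt L34 (y $ 1 + y $ 2) (y $ 2 - y $ 1) \<or>
      ?x = pt L13 (y $ 2) (y $ 4) \<or> ?x = pt L24 (y $ 1) (y $ 3) \<or>
      ?x = pt L23 (y $ 1) (y $ 4) \<or> ?x = pt L14 (y $ 2) (y $ 3)"
    using assms by (auto simp: vec_eq_iff forall_4)
  then show thesis by (elim disjE) (rule that; assumption)+
qed

text \<open>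
  A polynomial vanishes on all edges of the coordinate tetrahedron iff each of its monomials
  involves at least three of the coordinates.
\<close>

lemma mem_if_in_line_ideals:
  fixes A :: "'k::{field, field_char_0} coord_ring set"
  assumes A: "0 \<in> A" "\<And>f g. f \<in> A \<Longrightarrow> g \<in> A \<Longrightarrow> f + g \<in> A" "\<And>f g. f \<in> A \<Longrightarrow> g * f \<in> A"
    and triples: "\<And>i j k. (i, j, k) \<in> {(1, 2, 3), (1, 2, 4), (1, 3, 4), (2, 3, 4)} \<Longrightarrow>
      hyp Xvec $ i * hyp Xvec $ j * hyp Xvec $ k \<in> A"
    and f: "\<And>e. f \<in> line_ideal e"
  shows "f \<in> A"
proof -
  \<comment> \<open>The linear substitutions \<open>z\<close> and \<open>y\<close> are mutually
    inverse, for instance x_1 = y_1 + y_2 with y_1 = (x_1 - x_2)/2 and y_2 = (x_1 + x_2)/2. In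
    \<open>F\<close>, the polynomial \<open>f\<close> in the new coordinates, membership can be read
    off the monomials.\<close>
  define z :: "'k coord_ring ^ 4" where "z = vector [Xv 1 + Xv 2, Xv 2 - Xv 1, Xv 3 + Xv 4, Xv 4 - Xv 3]"
  define y :: "'k coord_ring ^ 4" where "y = (\<chi> i. cst (1/2) * hyp Xvec $ i)"
  define F where "F = poly_subst f z"
  have half: "2 * cst (1/2) = (1 :: 'k coord_ring)"
    by (subst single_numeral[symmetric]) (simp add: mult_single del: single_numeral)
  have "poly_subst (z $ i) y = Xvec $ i" for i
    by (rule all_4[of _ i]; simp add: z_def y_def hyp_def rhom.simps[OF rhom_poly_subst] algebra_simps half)
  then have "(\<chi> i. poly_subst (z $ i) y) = Xvec" by (simp add: vec_eq_iff)
  then have f_eq: "f = poly_subst F y"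
    by (simp add: F_def poly_subst_poly_subst)
  have no_pair: "Poly_Mapping.lookup m i \<noteq> 0 \<or> Poly_Mapping.lookup m j \<noteq> 0"
    if ij: "(i, j) \<in> {(1, 2), (3, 4), (1, 3), (2, 4), (2, 3), (1, 4)}" and m: "Poly_Mapping.lookup F m \<noteq> 0" for m i j
  proof (rule ccontr)
    assume *: "\<not> ?thesis"
    let ?g = "(\<chi> l. if l \<in> {i, j} then 0 else Xv l) :: 'k coord_ring ^ 4"
    have "(\<chi> l. poly_subst (z $ l) ?g) = vector [?g $ 1 + ?g $ 2, ?g $ 2 - ?g $ 1, ?g $ 3 + ?g $ 4, ?g $ 4 - ?g $ 3]"
      by (simp add: vec_eq_iff forall_4 z_def rhom.simps[OF rhom_poly_subst])
    also obtain e a b where "\<dots> = pt e a b"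
    proof (rule tetrahedron_edge[of i j ?g])
      show "?g $ i = 0" "?g $ j = 0" by simp_all
    qed (rule ij)
    finally have "(\<chi> l. poly_subst (z $ l) ?g) = pt e a b" .
    then have "poly_subst F ?g = 0"
      using poly_subst_pt_eq_0[OF f] by (auto simp: F_def poly_subst_poly_subst)
    moreover have "Poly_Mapping.lookup (poly_subst F ?g) m = Poly_Mapping.lookup F m"
      by (rule lookup_poly_subst_coordinate_subspace) (use * in auto)
    ultimately show False using m by simp
  qed
  have mon: "eval_mon y m \<in> A" if m: "m \<in> Poly_Mapping.keys F" for m
  proof -
    let ?c = "\<lambda>i. Poly_Mapping.lookup m i \<noteq> 0"
    \<comment> \<open>The six edges are all pairs of indices, so at most one of the four exponents
      is zero.\<close>
    have "?c 1 \<or> ?c 2" "?c 3 \<or> ?c 4" "?c 1 \<or> ?c 3" "?c 2 \<or> ?c 4" "?c 2 \<or> ?c 3" "?c 1 \<or> ?c 4"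
      using m no_pair[of 1 2 m] no_pair[of 3 4 m] no_pair[of 1 3 m] no_pair[of 2 4 m]
        no_pair[of 2 3 m] no_pair[of 1 4 m] by (simp_all add: in_keys_iff)
    then have "?c 1 \<and> ?c 2 \<and> ?c 3 \<or> ?c 1 \<and> ?c 2 \<and> ?c 4 \<or> ?c 1 \<and> ?c 3 \<and> ?c 4 \<or> ?c 2 \<and> ?c 3 \<and> ?c 4"
      by blast
    then obtain i j k where ijk: "?c i" "?c j" "?c k" "i \<noteq> j" "i \<noteq> k" "j \<noteq> k"
      and mem: "(i, j, k) \<in> {(1, 2, 3), (1, 2, 4), (1, 3, 4), (2, 3, 4)}"
      using that[of 1 2 3] that[of 1 2 4] that[of 1 3 4] that[of 2 3 4] by auto
    obtain r where "eval_mon y m = r * (y $ i * y $ j * y $ k)" using eval_mon_factor[OF ijk] by blast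
    also have "\<dots> = (r * (cst (1/2) * cst (1/2) * cst (1/2))) * (hyp Xvec $ i * hyp Xvec $ j * hyp Xvec $ k)"
      by (simp add: y_def mult_ac)
    finally show ?thesis using A(3)[OF triples[OF mem]] by simp
  qed
  have sum: "sum g S \<in> A" if "\<And>m. m \<in> S \<Longrightarrow> g m \<in> A" for S and g :: "_ \<Rightarrow> 'k coord_ring"
    using that by (induction S rule: infinite_finite_induct) (simp_all add: A)
  show "f \<in> A"
    unfolding f_eq poly_subst_eq_ev ev_def by (intro sum A(3) mon)
qed

section \<open>The ideal of the point scheme\<close>

abbreviation R_ideal :: "'k::field coord_ring set"
  where "R_ideal \<equiv> point_scheme_ideal relations_R"

lemma R_ideal_closure:
  fixes f g :: "'k::field coord_ring"
  shows "(0 :: 'k coord_ring) \<in> R_ideal" "f \<in> R_ideal \<Longrightarrow> g \<in> R_ideal \<Longrightarrow> f + g \<in> R_ideal" "f \<in> R_ideal \<Longrightarrow> g * f \<in> R_ideal"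
proof -
  interpret cring "coord_ring :: 'k coord_ring ring" by (rule cring_from_type_algebra)
  have "ideal (R_ideal :: 'k coord_ring set) coord_ring"
    unfolding point_scheme_ideal_def by (rule genideal_ideal) (simp add: ring_of_type_algebra_def)
  then show "(0 :: 'k coord_ring) \<in> R_ideal" "f \<in> R_ideal \<Longrightarrow> g \<in> R_ideal \<Longrightarrow> f + g \<in> R_ideal"
    "f \<in> R_ideal \<Longrightarrow> g * f \<in> R_ideal"
    by (simp_all add: ideal_coord_ring_iff)
qed

lemma R_ideal_subset:
  assumes "P \<in> Proj" "minors4 (rel_mat Xvec) \<subseteq> P"
  shows "R_ideal \<subseteq> P"
proof -
  interpret cring "coord_ring :: 'a coord_ring ring" by (rule cring_from_type_algebra)
  show ?thesis
    unfolding point_scheme_ideal_def relation_matrix_relations_R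
    by (rule genideal_minimal) (use assms in \<open>auto simp: Proj_def dest: primeideal.axioms(1)\<close>)
qed

lemma minors_in_R_ideal: "minors4 (rel_mat Xvec) \<subseteq> R_ideal"
proof -
  interpret cring "coord_ring :: 'a coord_ring ring" by (rule cring_from_type_algebra)
  show ?thesis
    unfolding point_scheme_ideal_def relation_matrix_relations_R
    by (rule genideal_self) (simp add: ring_of_type_algebra_def)
qed

lemma R_ideal_subset_line_ideal: "R_ideal \<subseteq> line_ideal e"
proof (rule R_ideal_subset[OF line_ideal_in_Proj], rule subsetI)
  fix f :: "'a coord_ring" assume "f \<in> minors4 (rel_mat Xvec)"
  then obtain s where f: "f = det (\<chi> i. rel_mat Xvec $ s i)" by (auto simp: minors4_def)
  let ?w = "pt (opp e) (coord1 e Xvec) (sg e (coord2 e Xvec)) :: 'a coord_ring ^ 4"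
  let ?A = "(\<chi> i. rel_mat (lpt e) $ s i) :: 'a coord_ring ^ 4 ^ 4"
  have "rel_mat (lpt e) *v ?w = 0" by (rule rel_mat_mult_pt)
  then have "?A *v ?w = 0"
    by (simp add: vec_eq_iff matrix_vector_mult_def)
  moreover have "?w \<noteq> 0" unfolding pt_eq_0_iff by (cases e) simp_all
  ultimately have "det ?A = 0" by (rule det_eq_0_if_kernel)
  moreover have "poly_subst f (lpt e) = det ?A"
    unfolding f rhom.det[OF rhom_poly_subst]
    by (rule arg_cong[of _ _ det]) (simp add: vec_eq_iff rhom_rel_mat[OF rhom_poly_subst])
  ultimately show "f \<in> line_ideal e" by (simp add: line_ideal_def)
qed

text \<open>Since 4 is the least index, the increasing selection of the rows a < b < c < d takes the
  value \<open>a\<close> at 4 and \<open>b\<close>, \<open>c\<close>, \<open>d\<close> at 1, 2, 3.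
  Row 6 counts as the lowest.\<close>

lemma minor_in_R_ideal:
  assumes "a < b" "b < c" "c < d"
    and f: "f = det (\<chi> i. rel_mat Xvec $ ((vector [b, c, d, a] :: 6 ^ 4) $ i)) \<or>
      f = - det (\<chi> i. rel_mat Xvec $ ((vector [b, c, d, a] :: 6 ^ 4) $ i))"
  shows "f \<in> R_ideal"
proof -
  let ?s = "($) (vector [b, c, d, a] :: 6 ^ 4)"
  have "x < y \<longrightarrow> ?s x < ?s y" for x y
    by (rule all_4[of _ x]; rule all_4[of _ y]; use assms(1-3) in \<open>auto intro: less_trans\<close>)
  then have "strict_mono ?s" by (simp add: strict_mono_def)
  then have "det (\<chi> i. rel_mat Xvec $ ?s i) \<in> R_ideal"
    using minors_in_R_ideal by (fastforce simp: minors4_def)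
  then show ?thesis
    using f R_ideal_closure(3)[of _ "- 1"] by auto
qed

text \<open>Twelve of the fifteen minors up to sign. Of the others, two repeat the first two entries
  up to sign and the one from rows 2 to 5 is zero.\<close>

lemma R_ideal_elements:
  defines "A \<equiv> Xv 1 ^ 2 - Xv 2 ^ 2 :: 'k::field coord_ring" and "B \<equiv> Xv 3 ^ 2 - Xv 4 ^ 2 :: 'k coord_ring"
  shows "Xv 3 * Xv 4 * A \<in> R_ideal" "Xv 1 * Xv 2 * B \<in> R_ideal"
    "Xv 1 * Xv 3 * A \<in> R_ideal" "Xv 1 * Xv 4 * A \<in> R_ideal"
    "Xv 2 * Xv 3 * A \<in> R_ideal" "Xv 2 * Xv 4 * A \<in> R_ideal"
    "Xv 1 * Xv 3 * B \<in> R_ideal" "Xv 1 * Xv 4 * B \<in> R_ideal"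
    "Xv 2 * Xv 3 * B \<in> R_ideal" "Xv 2 * Xv 4 * B \<in> R_ideal"
    "Xv 2 ^ 2 * Xv 4 ^ 2 - Xv 1 ^ 2 * Xv 3 ^ 2 \<in> (R_ideal :: 'k coord_ring set)"
    "Xv 1 ^ 2 * Xv 4 ^ 2 - Xv 2 ^ 2 * Xv 3 ^ 2 \<in> (R_ideal :: 'k coord_ring set)"
    subgoal by (rule minor_in_R_ideal[of 6 1 2 4]) (simp_all add: det_4 rel_mat_def A_def B_def algebra_simps power2_eq_square)
    subgoal by (rule minor_in_R_ideal[of 6 1 2 3]) (simp_all add: det_4 rel_mat_def A_def B_def algebra_simps power2_eq_square)
    subgoal by (rule minor_in_R_ideal[of 1 2 3 5]) (simp_all add: det_4 rel_mat_def A_def B_def algebra_simps power2_eq_square)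
    subgoal by (rule minor_in_R_ideal[of 1 2 3 4]) (simp_all add: det_4 rel_mat_def A_def B_def algebra_simps power2_eq_square)
    subgoal by (rule minor_in_R_ideal[of 1 3 4 5]) (simp_all add: det_4 rel_mat_def A_def B_def algebra_simps power2_eq_square)
    subgoal by (rule minor_in_R_ideal[of 1 2 4 5]) (simp_all add: det_4 rel_mat_def A_def B_def algebra_simps power2_eq_square)
    subgoal by (rule minor_in_R_ideal[of 6 2 3 5]) (simp_all add: det_4 rel_mat_def A_def B_def algebra_simps power2_eq_square)
    subgoal by (rule minor_in_R_ideal[of 6 2 3 4]) (simp_all add: det_4 rel_mat_def A_def B_def algebra_simps power2_eq_square)
    subgoal by (rule minor_in_R_ideal[of 6 3 4 5]) (simp_all add: det_4 rel_mat_def A_def B_def algebra_simps power2_eq_square)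
    subgoal by (rule minor_in_R_ideal[of 6 2 4 5]) (simp_all add: det_4 rel_mat_def A_def B_def algebra_simps power2_eq_square)
    subgoal by (rule minor_in_R_ideal[of 6 1 2 5]) (simp_all add: det_4 rel_mat_def A_def B_def algebra_simps power2_eq_square)
    subgoal by (rule minor_in_R_ideal[of 6 1 3 4]) (simp_all add: det_4 rel_mat_def A_def B_def algebra_simps power2_eq_square)
  done

text \<open>Triple products of the tetrahedral coordinates have the form A (x_3 \<plusminus> x_4) or
  B (x_1 \<plusminus> x_2), so it suffices to treat A x_3, A x_4, B x_1 and B x_2. After
  multiplication by a square of a variable most of these are multiples of a minor such as x_1 x_3 A;
  the terms A x_3^3, A x_4^3, B x_1^3 and B x_2^3 need combinations of several minors.\<close>

lemma square_mult_triple_in_R_ideal: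
  fixes l :: 4
  assumes "(i, j, k) \<in> {(1, 2, 3), (1, 2, 4), (1, 3, 4), (2, 3, 4)}"
  shows "Xv l ^ 2 * (hyp Xvec $ i * hyp Xvec $ j * hyp Xvec $ k) \<in> (R_ideal :: 'k::{field, field_char_0} coord_ring set)"
proof -
  define x :: "4 \<Rightarrow> 'k coord_ring" where "x = Xv"
  let ?A = "x 1 ^ 2 - x 2 ^ 2" and ?B = "x 3 ^ 2 - x 4 ^ 2"
  note elems = R_ideal_elements[where 'k='k, folded x_def]
  have minus: "f - g \<in> R_ideal" if "f \<in> R_ideal" "g \<in> R_ideal" for f g :: "'k coord_ring"
    using R_ideal_closure(2)[OF that(1) R_ideal_closure(3)[OF that(2), of "- 1"]] by simp
  have half: "f \<in> R_ideal" if "2 * f \<in> R_ideal" for f :: "'k coord_ring"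
  proof -
    have "cst (1/2) * 2 = (1 :: 'k coord_ring)"
      by (subst single_numeral[symmetric]) (simp add: mult_single del: single_numeral)
    then have "cst (1/2) * (2 * f) = f" by (simp flip: mult.assoc)
    then show ?thesis using that R_ideal_closure(3) by metis
  qed
  have A: "?A * (x 3 ^ 2 + x 4 ^ 2) \<in> R_ideal"
  proof -
    have "?A * (x 3 ^ 2 + x 4 ^ 2) =
        (x 1 ^ 2 * x 4 ^ 2 - x 2 ^ 2 * x 3 ^ 2) - (x 2 ^ 2 * x 4 ^ 2 - x 1 ^ 2 * x 3 ^ 2)"
      by (simp add: algebra_simps)
    then show ?thesis using minus[OF elems(12,11)] by simp
  qed
  have B: "?B * (x 1 ^ 2 + x 2 ^ 2) \<in> R_ideal"
  proof -
    have "?B * (x 1 ^ 2 + x 2 ^ 2) =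
        (- 1) * (x 1 ^ 2 * x 4 ^ 2 - x 2 ^ 2 * x 3 ^ 2) - (x 2 ^ 2 * x 4 ^ 2 - x 1 ^ 2 * x 3 ^ 2)"
      by (simp add: algebra_simps)
    then show ?thesis using minus[OF R_ideal_closure(3)[OF elems(12)] elems(11)] by (simp only:)
  qed
  \<comment> \<open>The product \<open>?A * ?B\<close> is y_1 y_2 y_3 y_4, the quartic missing from
    the ideal; one more variable brings it in.\<close>
  have AB: "x n * (?A * ?B) \<in> R_ideal" for n
  proof -
    have "x 3 * (?A * ?B) = x 1 * (x 1 * x 3 * ?B) - x 2 * (x 2 * x 3 * ?B)"
      "x 4 * (?A * ?B) = x 1 * (x 1 * x 4 * ?B) - x 2 * (x 2 * x 4 * ?B)"
      "x 1 * (?A * ?B) = x 3 * (x 1 * x 3 * ?A) - x 4 * (x 1 * x 4 * ?A)"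
      "x 2 * (?A * ?B) = x 3 * (x 2 * x 3 * ?A) - x 4 * (x 2 * x 4 * ?A)"
      by (simp_all add: algebra_simps power2_eq_square)
    then have "x 1 * (?A * ?B) \<in> R_ideal" "x 2 * (?A * ?B) \<in> R_ideal"
      "x 3 * (?A * ?B) \<in> R_ideal" "x 4 * (?A * ?B) \<in> R_ideal"
      by (simp_all only:) (intro minus R_ideal_closure(3) elems)+
    then show ?thesis by (rule all_4[of _ n])
  qed
  have A': "x l ^ 2 * (?A * x m) \<in> R_ideal" if m: "m = 3 \<or> m = 4" for m
  proof -
    \<comment> \<open>The last two identities rest on x_3^2 + x_4^2 \<plusminus> B being 2 x_3^2 or
      2 x_4^2; the factor 2 is removed afterwards by \<open>half\<close>.\<close>
    have "x 1 ^ 2 * (?A * x 3) = x 1 * (x 1 * x 3 * ?A)" "x 1 ^ 2 * (?A * x 4) = x 1 * (x 1 * x 4 * ?A)"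
      "x 2 ^ 2 * (?A * x 3) = x 2 * (x 2 * x 3 * ?A)" "x 2 ^ 2 * (?A * x 4) = x 2 * (x 2 * x 4 * ?A)"
      "x 3 ^ 2 * (?A * x 4) = x 3 * (x 3 * x 4 * ?A)" "x 4 ^ 2 * (?A * x 3) = x 4 * (x 3 * x 4 * ?A)"
      "2 * (x 3 ^ 2 * (?A * x 3)) = x 3 * (?A * (x 3 ^ 2 + x 4 ^ 2)) + x 3 * (?A * ?B)"
      "2 * (x 4 ^ 2 * (?A * x 4)) = x 4 * (?A * (x 3 ^ 2 + x 4 ^ 2)) - x 4 * (?A * ?B)"
      by (simp_all add: algebra_simps power2_eq_square)
    then have "x 1 ^ 2 * (?A * x 3) \<in> R_ideal" "x 1 ^ 2 * (?A * x 4) \<in> R_ideal"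
      "x 2 ^ 2 * (?A * x 3) \<in> R_ideal" "x 2 ^ 2 * (?A * x 4) \<in> R_ideal"
      "x 3 ^ 2 * (?A * x 4) \<in> R_ideal" "x 4 ^ 2 * (?A * x 3) \<in> R_ideal"
      "2 * (x 3 ^ 2 * (?A * x 3)) \<in> R_ideal" "2 * (x 4 ^ 2 * (?A * x 4)) \<in> R_ideal"
      by (simp_all only:) (intro minus R_ideal_closure(2,3) elems A AB)+
    then have "x l ^ 2 * (?A * x 3) \<in> R_ideal \<and> x l ^ 2 * (?A * x 4) \<in> R_ideal"
      by - (rule all_4[of _ l]; blast intro: half)
    then show ?thesis using m by blast
  qed
  have B': "x l ^ 2 * (?B * x m) \<in> R_ideal" if m: "m = 1 \<or> m = 2" for m
  proof -
    have "x 3 ^ 2 * (?B * x 1) = x 3 * (x 1 * x 3 * ?B)" "x 4 ^ 2 * (?B * x 1) = x 4 * (x 1 * x 4 * ?B)"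
      "x 3 ^ 2 * (?B * x 2) = x 3 * (x 2 * x 3 * ?B)" "x 4 ^ 2 * (?B * x 2) = x 4 * (x 2 * x 4 * ?B)"
      "x 1 ^ 2 * (?B * x 2) = x 1 * (x 1 * x 2 * ?B)" "x 2 ^ 2 * (?B * x 1) = x 2 * (x 1 * x 2 * ?B)"
      "2 * (x 1 ^ 2 * (?B * x 1)) = x 1 * (?B * (x 1 ^ 2 + x 2 ^ 2)) + x 1 * (?A * ?B)"
      "2 * (x 2 ^ 2 * (?B * x 2)) = x 2 * (?B * (x 1 ^ 2 + x 2 ^ 2)) - x 2 * (?A * ?B)"
      by (simp_all add: algebra_simps power2_eq_square)
    then have "x 3 ^ 2 * (?B * x 1) \<in> R_ideal" "x 4 ^ 2 * (?B * x 1) \<in> R_ideal"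
      "x 3 ^ 2 * (?B * x 2) \<in> R_ideal" "x 4 ^ 2 * (?B * x 2) \<in> R_ideal"
      "x 1 ^ 2 * (?B * x 2) \<in> R_ideal" "x 2 ^ 2 * (?B * x 1) \<in> R_ideal"
      "2 * (x 1 ^ 2 * (?B * x 1)) \<in> R_ideal" "2 * (x 2 ^ 2 * (?B * x 2)) \<in> R_ideal"
      by (simp_all only:) (intro minus R_ideal_closure(2,3) elems B AB)+
    then have "x l ^ 2 * (?B * x 1) \<in> R_ideal \<and> x l ^ 2 * (?B * x 2) \<in> R_ideal"
      by - (rule all_4[of _ l]; blast intro: half)
    then show ?thesis using m by blast
  qed
  have prods: "x l ^ 2 * (hyp Xvec $ 1 * hyp Xvec $ 2 * hyp Xvec $ 3) = x l ^ 2 * (?A * x 3) - x l ^ 2 * (?A * x 4)"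
    "x l ^ 2 * (hyp Xvec $ 1 * hyp Xvec $ 2 * hyp Xvec $ 4) = x l ^ 2 * (?A * x 3) + x l ^ 2 * (?A * x 4)"
    "x l ^ 2 * (hyp Xvec $ 1 * hyp Xvec $ 3 * hyp Xvec $ 4) = x l ^ 2 * (?B * x 1) - x l ^ 2 * (?B * x 2)"
    "x l ^ 2 * (hyp Xvec $ 2 * hyp Xvec $ 3 * hyp Xvec $ 4) = x l ^ 2 * (?B * x 1) + x l ^ 2 * (?B * x 2)"
    by (simp_all add: hyp_def x_def algebra_simps power2_eq_square)
  have "x l ^ 2 * (hyp Xvec $ 1 * hyp Xvec $ 2 * hyp Xvec $ 3) \<in> R_ideal"
    "x l ^ 2 * (hyp Xvec $ 1 * hyp Xvec $ 2 * hyp Xvec $ 4) \<in> R_ideal"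
    "x l ^ 2 * (hyp Xvec $ 1 * hyp Xvec $ 3 * hyp Xvec $ 4) \<in> R_ideal"
    "x l ^ 2 * (hyp Xvec $ 2 * hyp Xvec $ 3 * hyp Xvec $ 4) \<in> R_ideal"
    unfolding prods by (intro minus R_ideal_closure(2) A' B'; simp)+
  with assms show ?thesis by (auto simp: x_def)
qed

text \<open>The colon ideal of all f with x_l^2 f in the ideal of minors contains the triple
  products, hence the whole intersection of the line ideals.\<close>

lemma square_mult_in_R_ideal:
  fixes f :: "'k::{field, field_char_0} coord_ring"
  assumes "\<And>e. f \<in> line_ideal e"
  shows "Xv l ^ 2 * f \<in> R_ideal"
proof -
  have "f \<in> {f. Xv l ^ 2 * f \<in> R_ideal}"
  proof (rule mem_if_in_line_ideals[OF _ _ _ _ assms])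
    show "g * h \<in> {f. Xv l ^ 2 * f \<in> R_ideal}" if "h \<in> {f. Xv l ^ 2 * f \<in> R_ideal}" for g h
      using that R_ideal_closure(3)[of "Xv l ^ 2 * h" g] by (simp add: mult.left_commute)
  qed (use square_mult_triple_in_R_ideal R_ideal_closure(1,2) in \<open>simp_all only: mem_Collect_eq distrib_left mult_zero_right\<close>)
  then show ?thesis by simp
qed

text \<open>Vanishing of a germ can be tested line by line. The multiplier \<open>s\<close> is free
  to kill lines not passing through \<open>P\<close>; a square x_k^2 that avoids \<open>P\<close>
  then moves the product from J into the ideal of minors.\<close>

lemma germ_zero_R_idealI:
  fixes f :: "'k::{field, field_char_0} coord_ring"
  assumes P: "proj_point P" and s: "s \<notin> P" "\<And>e. s * f \<in> line_ideal e"
  shows "germ_zero R_ideal P f"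
proof -
  obtain k where k: "Xv k \<notin> P" using proj_point.ex_Xv[OF P] ..
  have "Xv k ^ 2 * s * f \<in> R_ideal"
    using square_mult_in_R_ideal[OF s(2)] by (simp add: mult.assoc)
  moreover have "Xv k ^ 2 * s \<notin> P"
    using k s(1) proj_point.power[OF P] by (auto simp: proj_point.mult_iff[OF P])
  ultimately show ?thesis unfolding germ_zero_def by blast
qed

section \<open>Support and reducedness of the point scheme\<close>

lemma proj_point_line_ideal: "proj_point (line_ideal e)"
  by (simp add: proj_point_def line_ideal_in_Proj)

lemma UNIV_line: "(UNIV :: line set) = {L12, L34, L13, L24, L23, L14}"
  using line.exhaust by auto

text \<open>If \<open>P\<close> contained no line ideal, choose one element outside \<open>P\<close>
  from each. Their product lies in J, so a multiple by some x_k^2 outside \<open>P\<close> lies in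
  the ideal of minors and thus in \<open>P\<close>, against primality.\<close>

lemma zeros_R_ideal:
  "zeros (R_ideal :: 'k::{field, field_char_0} coord_ring set) = (\<Union>e. zeros (line_ideal e))"
proof (intro equalityI subsetI)
  fix P :: "'k coord_ring set" assume P: "P \<in> zeros R_ideal"
  then interpret proj_point P by (simp add: proj_point_def zeros_def)
  show "P \<in> (\<Union>e. zeros (line_ideal e))"
  proof (rule ccontr)
    assume "P \<notin> (\<Union>e. zeros (line_ideal e))"
    then have "\<exists>f. f \<in> line_ideal e \<and> f \<notin> P" for e
      using Proj by (auto simp: zeros_def)
    then obtain f where f: "\<And>e. f e \<in> line_ideal e" "\<And>e. f e \<notin> P" by metis
    have fin: "finite (UNIV :: line set)" by (simp add: UNIV_line)
    have "prod f UNIV \<in> line_ideal e" for e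
      using f(1) by (subst prod.remove[OF fin]) (auto intro: proj_point.mult_right[OF proj_point_line_ideal])
    moreover obtain k where k: "Xv k \<notin> P" using ex_Xv ..
    ultimately have "Xv k ^ 2 * prod f UNIV \<in> P"
      using square_mult_in_R_ideal P by (auto simp: zeros_def)
    moreover have "prod f S \<notin> P" for S
      by (induction S rule: infinite_finite_induct) (simp_all add: one mult_iff f)
    ultimately show False using k power by (auto simp: mult_iff)
  qed
next
  fix P :: "'k coord_ring set" assume "P \<in> (\<Union>e. zeros (line_ideal e))"
  then show "P \<in> zeros R_ideal" using R_ideal_subset_line_ideal by (fastforce simp: zeros_def)
qed

text \<open>Each line ideal is prime, so s f^n in all of them forces s f in all of them, and the
  same \<open>s\<close> witnesses that f is zero.\<close>

lemma reduced_R_ideal: "reduced_scheme (R_ideal :: 'k::{field, field_char_0} coord_ring set)"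
  unfolding reduced_scheme_def
proof (intro ballI allI impI)
  fix P :: "'k coord_ring set" and f n
  assume P: "P \<in> zeros R_ideal" and "germ_zero R_ideal P (f ^ n)"
  then obtain s where s: "s \<notin> P" "s * f ^ n \<in> R_ideal" by (auto simp: germ_zero_def)
  have "s * f \<in> line_ideal e" for e
  proof -
    interpret proj_point "line_ideal e :: 'k coord_ring set" by (rule proj_point_line_ideal)
    have "s * f ^ n \<in> line_ideal e" using s R_ideal_subset_line_ideal by blast
    then show ?thesis using power by (auto simp: mult_iff)
  qed
  moreover have "proj_point P" using P by (simp add: zeros_def proj_point_def)
  ultimately show "germ_zero R_ideal P f" using s(1) by (intro germ_zero_R_idealI)
qed

section \<open>Closed points\<close>

lemma poly_at_scale:
  assumes "homogeneous d f"
  shows "poly_at f (t *s v) = poly_at f v * t ^ d"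
  using ev_homogeneous_line[OF rhom_id assms, of v t]
  by (simp add: poly_at_eq_ev vector_scalar_mult_def mult.commute)

definition point_ideal :: "'k::field ^ 4 \<Rightarrow> 'k coord_ring set"
  where "point_ideal v = {f. \<forall>d. poly_at (hcomp d f) v = 0}"

text \<open>Restricting f to the multiples t v gives a polynomial in t whose coefficients are the
  values of the homogeneous components at v. Over an infinite field it vanishes identically only if
  all of them are zero.\<close>

lemma vanishing_ideal_span:
  fixes v :: "'k::{field, field_char_0} ^ 4"
  shows "{f. \<forall>x\<in>vec.span {v}. poly_at f x = 0} = point_ideal v"
proof (intro equalityI subsetI)
  fix f assume "f \<in> {f. \<forall>x\<in>vec.span {v}. poly_at f x = 0}"
  then have 0: "poly_at f (t *s v) = 0" for t by (simp add: vec.span_singleton)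
  obtain D where D: "f = (\<Sum>d\<le>D. hcomp d f)" using hcomp_decomposition ..
  define p where "p = (\<Sum>d\<le>D. Polynomial.monom (poly_at (hcomp d f) v) d)"
  have "poly p t = 0" for t
  proof -
    have "poly p t = (\<Sum>d\<le>D. poly_at (hcomp d f) (t *s v))"
      by (simp add: p_def poly_sum poly_monom poly_at_scale[OF homogeneous_hcomp])
    also have "\<dots> = poly_at (\<Sum>d\<le>D. hcomp d f) (t *s v)"
      by (simp add: rhom.sum[OF rhom_poly_at])
    finally show ?thesis using 0 D by simp
  qed
  then have "p = 0" using poly_all_0_iff_0[of p] by blast
  moreover have "Polynomial.coeff p d = (if d \<le> D then poly_at (hcomp d f) v else 0)" for d
    by (simp add: p_def coeff_sum)
  ultimately have le: "poly_at (hcomp d f) v = 0" if "d \<le> D" for d using that by (metis Polynomial.coeff_0)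
  have gt: "hcomp d f = 0" if "\<not> d \<le> D" for d
  proof -
    have "hcomp d f = (\<Sum>e\<le>D. hcomp d (hcomp e f))" by (metis D hcomp_sum)
    then show ?thesis using that by (simp add: hcomp_hcomp)
  qed
  have "poly_at (hcomp d f) v = 0" for d
    by (cases "d \<le> D") (simp_all add: le gt rhom.zero[OF rhom_poly_at])
  then show "f \<in> point_ideal v" by (simp add: point_ideal_def)
next
  fix f assume f: "f \<in> point_ideal v"
  obtain D where D: "f = (\<Sum>d\<le>D. hcomp d f)" using hcomp_decomposition ..
  have "poly_at (hcomp d f) (t *s v) = 0" for t d
    using f by (simp add: poly_at_scale[OF homogeneous_hcomp] point_ideal_def)
  then have "poly_at f (t *s v) = 0" for t
    by (subst D) (simp add: rhom.sum[OF rhom_poly_at])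
  then show "f \<in> {f. \<forall>x\<in>vec.span {v}. poly_at f x = 0}" by (auto simp: vec.span_singleton)
qed

lemma poly_subst_line_eq_0:
  assumes "f \<in> point_ideal v"
  shows "poly_subst f (\<chi> i. cst (v $ i) * l) = 0"
proof -
  obtain D where D: "f = (\<Sum>d\<le>D. hcomp d f)" using hcomp_decomposition ..
  have "poly_subst (hcomp d f) (\<chi> i. cst (v $ i) * l) = 0" for d
    using assms by (simp add: poly_subst_eq_ev point_ideal_def ev_homogeneous_line[OF rhom_cst homogeneous_hcomp])
  then show ?thesis
    by (subst D) (simp add: rhom.sum[OF rhom_poly_subst])
qed

text \<open>Here \<open>Xv 1\<close> merely parametrizes the line through \<open>v\<close>. Written
  as the kernel of a linear substitution, the ideal is seen to be a point of
  \<open>Proj\<close>.\<close>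

lemma point_ideal_eq_kernel:
  fixes v :: "'k::{field, field_char_0} ^ 4"
  shows "point_ideal v = {f. poly_subst f (\<chi> i. cst (v $ i) * Xv 1) = 0}"
proof (intro equalityI subsetI)
  fix f assume "f \<in> {f. poly_subst f (\<chi> i. cst (v $ i) * Xv 1) = 0}"
  then have "poly_at (poly_subst f (\<chi> i. cst (v $ i) * Xv 1)) ((\<chi> i. t) :: 'k ^ 4) = 0" for t
    by (simp add: rhom.zero[OF rhom_poly_at])
  then have "poly_at f (t *s v) = 0" for t
    by (simp add: poly_at_poly_subst rhom.mult[OF rhom_poly_at] vector_scalar_mult_def mult.commute)
  then have "f \<in> {f. \<forall>x\<in>vec.span {v}. poly_at f x = 0}" by (auto simp: vec.span_singleton)
  then show "f \<in> point_ideal v" by (simp only: vanishing_ideal_span)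
qed (simp add: poly_subst_line_eq_0)

lemma point_ideal_in_Proj:
  fixes v :: "'k::{field, field_char_0} ^ 4"
  assumes "v \<noteq> 0"
  shows "point_ideal v \<in> Proj"
proof -
  obtain k where "v $ k \<noteq> 0" using assms by (auto simp: vec_eq_iff)
  then have "cst (v $ k) \<noteq> 0" by (metis lookup_single_eq lookup_zero)
  then show ?thesis
    unfolding point_ideal_eq_kernel
    by (intro kernel_in_Proj[of _ k]) (simp_all add: homogeneous_cst_mult homogeneous_Xv[simplified])
qed

text \<open>Modulo \<open>P\<close> a form f of degree d becomes f(v) l^d. As \<open>l\<close> lies
  outside \<open>P\<close> (otherwise all variables would lie inside), membership in
  \<open>P\<close> depends on f(v) alone. The congruences persist in larger primes, which is how
  maximality follows later.\<close>

lemma (in proj_point) eq_point_ideal: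
  assumes cong: "\<And>i. Xv i - cst (v $ i) * l \<in> P"
  shows "P = point_ideal v"
proof (intro equalityI subsetI)
  have sub: "f - poly_subst f (\<chi> i. cst (v $ i) * l) \<in> P" for f
    using cong_poly_subst[of Xvec "\<chi> i. cst (v $ i) * l" f] cong by simp
  {
    fix f assume f: "f \<in> P"
    have "poly_at (hcomp d f) v = 0" for d
    proof (rule ccontr)
      assume nz: "poly_at (hcomp d f) v \<noteq> 0"
      have "poly_subst (hcomp d f) (\<chi> i. cst (v $ i) * l) \<in> P"
        using cong_mem[OF sub] hcomp[OF f] by simp
      then have "cst (poly_at (hcomp d f) v) * l ^ d \<in> P"
        by (simp add: poly_subst_eq_ev ev_homogeneous_line[OF rhom_cst homogeneous_hcomp])
      then have "l \<in> P" using cst[OF nz] power by (auto simp: mult_iff)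
      then have "Xv i \<in> P" for i using cong_mem[OF cong] by (simp add: mult_left)
      then show False using ex_Xv by blast
    qed
    then show "f \<in> point_ideal v" by (simp add: point_ideal_def)
  next
    fix f assume "f \<in> point_ideal v"
    then show "f \<in> P" using sub[of f] by (simp add: poly_subst_line_eq_0)
  }
qed

lemma span_singleton_scale:
  assumes "c \<noteq> (0::'a::field)"
  shows "vec.span {c *s x} = vec.span {x :: 'a ^ 'n}"
proof -
  have "x = (1 / c) *s (c *s x)" using assms by (simp add: vector_smult_assoc)
  then have "x \<in> vec.span {c *s x}" by (metis vec.span_base vec.span_scale insertI1)
  moreover have "c *s x \<in> vec.span {x}" by (simp add: vec.span_base vec.span_scale)
  ultimately show ?thesis by (simp add: vec.span_eq)
qed

lemma kpoints_eq:
  "kpoints Z = {vec.span {v} | v :: 'k::{field, field_char_0} ^ 4. v \<noteq> 0 \<and> point_ideal v \<in> Z}"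
proof (intro equalityI subsetI)
  fix L assume "L \<in> kpoints Z"
  then have L: "vec.subspace L" "vec.dim L = 1" "{f. \<forall>v\<in>L. poly_at f v = 0} \<in> Z"
    by (auto simp: kpoints_def)
  obtain B where B: "B \<subseteq> L" "vec.independent B" "L \<subseteq> vec.span B" "card B = 1"
    using vec.basis_exists[of L] L(2) by metis
  then obtain v where "B = {v}" by (auto simp: card_1_singleton_iff)
  with B L have "v \<noteq> 0" "L = vec.span {v}"
    using vec.span_minimal[of "{v}" L] by (auto simp: vec.dependent_single)
  moreover from this have "point_ideal v \<in> Z"
    using L(3) by (simp add: vanishing_ideal_span)
  ultimately show "L \<in> {vec.span {v} | v. v \<noteq> 0 \<and> point_ideal v \<in> Z}" by blast
next
  fix L assume "L \<in> {vec.span {v} | v :: 'k ^ 4. v \<noteq> 0 \<and> point_ideal v \<in> Z}"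
  then obtain v where v: "L = vec.span {v}" "v \<noteq> 0" "point_ideal v \<in> Z" by blast
  then have "vec.dim L = 1"
    using vec.dim_eq_card_independent[of "{v}"] by (simp add: vec.dependent_single)
  with v show "L \<in> kpoints Z"
    by (simp add: kpoints_def vec.subspace_span vanishing_ideal_span)
qed

lemma mem_point_ideal_if_homogeneous:
  assumes "homogeneous d f"
  shows "f \<in> point_ideal v \<longleftrightarrow> poly_at f v = 0"
  using assms by (auto simp: point_ideal_def hcomp_homogeneous rhom.zero[OF rhom_poly_at])

lemma homogeneous_eqs: "f \<in> eqs e Xvec \<Longrightarrow> homogeneous 1 f"
  by (cases e) (auto simp: homogeneous_Xv[simplified] homogeneous_add homogeneous_diff)

lemma point_ideal_in_line_iff:
  fixes v :: "'k::{field, field_char_0} ^ 4"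
  assumes "v \<noteq> 0"
  shows "point_ideal v \<in> zeros (line_ideal e) \<longleftrightarrow> (\<exists>a b. v = pt e a b)"
proof -
  have "point_ideal v \<in> zeros (line_ideal e) \<longleftrightarrow> eqs e Xvec \<subseteq> point_ideal v"
    unfolding zeros_eqs[symmetric] by (simp add: zeros_def point_ideal_in_Proj[OF assms])
  also have "\<dots> \<longleftrightarrow> (\<forall>f\<in>eqs e Xvec. poly_at f v = 0)"
    using mem_point_ideal_if_homogeneous[OF homogeneous_eqs] by blast
  also have "\<dots> \<longleftrightarrow> (\<lambda>f. poly_at f v) ` eqs e Xvec \<subseteq> {0}" by blast
  also have "\<dots> \<longleftrightarrow> eqs e v \<subseteq> {0}" by (simp add: rhom_eqs[OF rhom_poly_at])
  also have "\<dots> \<longleftrightarrow> (\<exists>a b. v = pt e a b)"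
    using pt_if_eqs eqs_pt by (metis order_refl)
  finally show ?thesis .
qed

lemma kpoints_line:
  "kpoints (zeros (line_ideal e)) =
    {vec.span {pt e a b} | a b :: 'k::{field, field_char_0}. (a, b) \<noteq> (0, 0)}"
proof -
  have "kpoints (zeros (line_ideal e)) = {vec.span {v} | v :: 'k ^ 4. v \<noteq> 0 \<and> (\<exists>a b. v = pt e a b)}"
    unfolding kpoints_eq using point_ideal_in_line_iff by blast
  also have "\<dots> = {vec.span {pt e a b} | a b :: 'k. pt e a b \<noteq> 0}" by blast
  finally show ?thesis by (simp add: pt_eq_0_iff)
qed

section \<open>The automorphism\<close>

lemma rel_mat_scale: "rel_mat (c *s v) *v x = c *s (rel_mat v *v x)"
  by (simp add: rel_mat_def vec_eq_iff forall_6 matrix_vector_mult_def sum_4 algebra_simps)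

lemma tau_span: "tau relations_R (vec.span {v}) = {x. rel_mat v *v x = 0}"
proof -
  have "(\<forall>y\<in>vec.span {v}. rel_mat y *v x = 0) \<longleftrightarrow> rel_mat v *v x = 0" for x
    using rel_mat_scale[of 1 v] by (auto simp: vec.span_singleton rel_mat_scale vec_eq_iff)
  then show ?thesis by (simp add: tau_def matrix_at_relations_R)
qed

lemma tau_pt:
  "(a, b) \<noteq> (0, 0) \<Longrightarrow> tau relations_R (vec.span {pt e a b}) = vec.span {pt (opp e) a (sg e b)}"
  unfolding tau_span by (rule kernel_rel_mat_pt)

lemma sg_eq_0_iff [simp]: "sg e b = 0 \<longleftrightarrow> b = 0"
  by (cases e) simp_all

lemma tau_image_kpoints:
  "tau relations_R ` kpoints (zeros (line_ideal e)) =
    kpoints (zeros (line_ideal (opp e) :: 'k::{field, field_char_0} coord_ring set))"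
proof (intro equalityI subsetI)
  fix L :: "('k ^ 4) set" assume "L \<in> tau relations_R ` kpoints (zeros (line_ideal e))"
  then obtain a b where "(a, b) \<noteq> (0, 0)" "L = tau relations_R (vec.span {pt e a b})"
    unfolding kpoints_line by blast
  then have "L = vec.span {pt (opp e) a (sg e b)}" "(a, sg e b) \<noteq> (0, 0)"
    by (auto simp: tau_pt)
  then show "L \<in> kpoints (zeros (line_ideal (opp e)))" unfolding kpoints_line by blast
next
  fix L :: "('k ^ 4) set" assume "L \<in> kpoints (zeros (line_ideal (opp e)))"
  then obtain a b where ab: "(a, b) \<noteq> (0, 0)" "L = vec.span {pt (opp e) a b}"
    unfolding kpoints_line by blast
  then have "(a, sg (opp e) b) \<noteq> (0, 0)" by simp
  moreover from this have "L = tau relations_R (vec.span {pt e a (sg (opp e) b)})"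
    by (simp add: tau_pt ab)
  ultimately show "L \<in> tau relations_R ` kpoints (zeros (line_ideal e))"
    unfolding kpoints_line by blast
qed

lemma rank_rel_mat_pt:
  assumes "(a, b) \<noteq> (0, 0)"
  shows "rank (rel_mat (pt e a b)) = 3"
proof -
  have "pt (opp e) a (sg e b) \<noteq> 0" using assms by (simp add: pt_eq_0_iff)
  from rank_one_dim_kernel[OF kernel_rel_mat_pt[OF assms] this] show ?thesis by simp
qed

lemma pt_if_in_kpoints:
  fixes v :: "'k::{field, field_char_0} ^ 4"
  assumes "L \<in> kpoints (zeros R_ideal)" "v \<in> L" "v \<noteq> 0"
  obtains e a b where "v = pt e a b" "(a, b) \<noteq> (0, 0)" "L = vec.span {v}"
proof -
  obtain x where x: "x \<noteq> 0" "L = vec.span {x}" "point_ideal x \<in> zeros R_ideal"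
    using assms(1) unfolding kpoints_eq by blast
  then obtain e a b where "x = pt e a b"
    using point_ideal_in_line_iff unfolding zeros_R_ideal by blast
  moreover obtain c where c: "v = c *s x" using assms(2) x by (auto simp: vec.span_singleton)
  ultimately have v: "v = pt e (c * a) (c * b)" by (simp add: scale_pt)
  have "c \<noteq> 0" using c assms(3) by auto
  then have "vec.span {v} = L"
    unfolding c x(2) by (rule span_singleton_scale)
  moreover have "(c * a, c * b) \<noteq> (0, 0)" using v assms(3) by (auto simp: pt_eq_0_iff)
  ultimately show thesis using that v by metis
qed

section \<open>Charts of tau and the scheme automorphism\<close>

abbreviation chart_domain :: "4 \<Rightarrow> 'k::field coord_ring set set"
  where "chart_domain k \<equiv> zeros R_ideal - zeros {hyp Xvec $ k}"

definition tau_charts :: "'k::field chart set"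
  where "tau_charts = range (\<lambda>k. (chart_domain k, chart Xvec $ k))"

lemma chart_chart_pt:
  assumes "hyp (pt e a b) $ k \<noteq> 0" "hyp (chart (pt e a b) $ k) $ l \<noteq> 0"
  shows "\<exists>c. chart (chart (pt e a b) $ k) $ l = c *s pt e a b"
proof -
  obtain c where c: "chart (pt e a b) $ k = c *s pt (opp e) a (sg e b)"
    using chart_pt[OF assms(1)] by blast
  then have "hyp (pt (opp e) a (sg e b)) $ l \<noteq> 0"
    using assms(2) by (auto simp: hyp_scale)
  then obtain d where "chart (pt (opp e) a (sg e b)) $ l = d *s pt (opp (opp e)) a (sg (opp e) (sg e b))"
    using chart_pt by blast
  then have "chart (chart (pt e a b) $ k) $ l = (c * d) *s pt e a b"
    by (simp add: c chart_scale vector_smult_assoc)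
  then show ?thesis ..
qed

lemma chart_domainD:
  assumes "P \<in> chart_domain k"
  shows "proj_point P" "hyp Xvec $ k \<notin> P"
  using assms by (auto simp: zeros_def proj_point_def)

lemma homogeneous_chart: "homogeneous 1 (chart Xvec $ k $ i)"
  by (rule all_4[of _ k]; rule all_4[of _ i];
    simp add: chart_def homogeneous_uminus homogeneous_Xv[simplified])

lemma homogeneous_hyp: "homogeneous 1 (hyp Xvec $ k)"
  by (rule all_4[of _ k]; simp add: hyp_def homogeneous_Xv[simplified] homogeneous_add homogeneous_diff)

text \<open>The entries of a chart are the four variables, permuted and with signs, so they have no
  common zero.\<close>

lemma (in proj_point) ex_chart: "\<exists>i. chart Xvec $ k $ i \<notin> P"
proof (rule ccontr)
  assume "\<not> ?thesis"
  then have c: "chart Xvec $ k $ i \<in> P" for i by blast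
  have uminus_iff: "- f \<in> P \<longleftrightarrow> f \<in> P" for f using uminus[of f] uminus[of "- f"] by auto
  have "(\<forall>i. chart Xvec $ k $ i \<in> P) \<longrightarrow> Xv 1 \<in> P \<and> Xv 2 \<in> P \<and> Xv 3 \<in> P \<and> Xv 4 \<in> P"
    by (rule all_4[of _ k]; simp add: chart_def forall_4 uminus_iff)
  then have "\<forall>j. Xv j \<in> P" using c by (simp add: forall_4)
  then show False using ex_Xv by blast
qed

text \<open>The multiplier is \<open>hyp Xvec $ k\<close>. It vanishes on the lines inside the
  plane, and the other lines are sent by the chart into \<open>opp e\<close>, where the ideal of
  minors vanishes.\<close>

lemma is_chart_tau:
  fixes k :: 4
  shows "is_chart (R_ideal :: 'k::{field, field_char_0} coord_ring set) (chart_domain k, chart Xvec $ k)"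
proof -
  have "germ_zero R_ideal P (poly_subst F (chart Xvec $ k))"
    if F: "F \<in> R_ideal" and P: "P \<in> chart_domain k" for P and F :: "'k coord_ring"
  proof (rule germ_zero_R_idealI[OF chart_domainD[OF P]])
    fix e
    have "hyp (lpt e) $ k * poly_subst F (chart (lpt e) $ k) = 0"
    proof (cases "hyp (lpt e :: 'k coord_ring ^ 4) $ k = 0")
      case False
      from chart_pt[OF this] obtain c
        where "chart (lpt e) $ k = c *s pt (opp e) (coord1 e Xvec) (sg e (coord2 e Xvec :: 'k coord_ring))" by blast
      then show ?thesis
        using poly_subst_pt_eq_0[of F "opp e"] F R_ideal_subset_line_ideal[of "opp e"]
        by (auto simp: scale_pt)
    qed simp
    then show "hyp Xvec $ k * poly_subst F (chart Xvec $ k) \<in> line_ideal e"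
      by (simp add: line_ideal_def rhom.mult[OF rhom_poly_subst] rhom_hyp[OF rhom_poly_subst]
          poly_subst_poly_subst rhom_chart[OF rhom_poly_subst])
  qed
  moreover have "\<exists>d. \<forall>i. homogeneous d (chart Xvec $ k $ i :: 'k coord_ring)"
    using homogeneous_chart by blast
  moreover have "\<exists>i. chart Xvec $ k $ i \<notin> P" if "P \<in> chart_domain k" for P :: "'k coord_ring set"
    using that by (intro proj_point.ex_chart chart_domainD(1))
  ultimately show ?thesis
    unfolding is_chart_def using openin_scheme_space by simp
qed

text \<open>With the product of both plane forms as multiplier, on each line either the multiplier
  vanishes or both charts are multiples of the same vector, which makes the 2 by 2 minors
  zero.\<close>

lemma germ_zero_charts:
  fixes P :: "'k::{field, field_char_0} coord_ring set"
  assumes P: "proj_point P" and k: "hyp Xvec $ k \<notin> P" and l: "hyp Xvec $ l \<notin> P"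
  shows "germ_zero R_ideal P (chart Xvec $ k $ i * chart Xvec $ l $ j - chart Xvec $ k $ j * chart Xvec $ l $ i)"
proof (rule germ_zero_R_idealI[OF P])
  show "hyp Xvec $ k * hyp Xvec $ l \<notin> P"
    using k l by (simp add: proj_point.mult_iff[OF P])
  fix e
  let ?x = "lpt e :: 'k coord_ring ^ 4"
  have "hyp ?x $ k * hyp ?x $ l * (chart ?x $ k $ i * chart ?x $ l $ j - chart ?x $ k $ j * chart ?x $ l $ i) = 0"
  proof (cases "hyp ?x $ k = 0 \<or> hyp ?x $ l = 0")
    case False
    then obtain c d where "chart ?x $ k = c *s pt (opp e) (coord1 e Xvec) (sg e (coord2 e Xvec))"
      "chart ?x $ l = d *s pt (opp e) (coord1 e Xvec) (sg e (coord2 e Xvec))"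
      using chart_pt by meson
    then show ?thesis by (simp add: algebra_simps)
  qed auto
  then show "hyp Xvec $ k * hyp Xvec $ l *
      (chart Xvec $ k $ i * chart Xvec $ l $ j - chart Xvec $ k $ j * chart Xvec $ l $ i) \<in> (line_ideal e :: 'k coord_ring set)"
    by (simp add: line_ideal_def rhom.simps[OF rhom_poly_subst] rhom_hyp[OF rhom_poly_subst]
        rhom_chart[OF rhom_poly_subst])
qed

text \<open>The second plane form is pulled back along the first chart. On a line where neither
  factor vanishes, both charts represent tau and their composite is a multiple of the
  parametrization.\<close>

lemma germ_zero_chart_chart:
  fixes P :: "'k::{field, field_char_0} coord_ring set"
  assumes P: "proj_point P" and k: "hyp Xvec $ k \<notin> P" and l: "hyp (chart Xvec $ k) $ l \<notin> P"
  shows "germ_zero R_ideal P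
    (chart (chart Xvec $ k) $ l $ i * Xv j - chart (chart Xvec $ k) $ l $ j * Xv i)"
proof (rule germ_zero_R_idealI[OF P])
  show "hyp Xvec $ k * hyp (chart Xvec $ k) $ l \<notin> P"
    using k l by (simp add: proj_point.mult_iff[OF P])
  fix e
  let ?x = "lpt e :: 'k coord_ring ^ 4"
  have "hyp ?x $ k * hyp (chart ?x $ k) $ l *
      (chart (chart ?x $ k) $ l $ i * ?x $ j - chart (chart ?x $ k) $ l $ j * ?x $ i) = 0"
  proof (cases "hyp ?x $ k = 0 \<or> hyp (chart ?x $ k) $ l = 0")
    case False
    then obtain c where "chart (chart ?x $ k) $ l = c *s ?x" using chart_chart_pt by blast
    then show ?thesis by (simp add: algebra_simps)
  qed auto
  then show "hyp Xvec $ k * hyp (chart Xvec $ k) $ l *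
      (chart (chart Xvec $ k) $ l $ i * Xv j - chart (chart Xvec $ k) $ l $ j * Xv i) \<in> (line_ideal e :: 'k coord_ring set)"
    by (simp add: line_ideal_def rhom.simps[OF rhom_poly_subst] rhom_hyp[OF rhom_poly_subst]
        rhom_chart[OF rhom_poly_subst])
qed

text \<open>Sums and differences of the four plane forms give twice each variable, so with 2
  invertible the four planes have no common point and the chart domains cover the scheme.\<close>

lemma (in proj_point) ex_hyp:
  assumes "(2 :: 'k) \<noteq> 0"
  shows "\<exists>k. hyp Xvec $ k \<notin> P"
proof (rule ccontr)
  assume "\<not> ?thesis"
  then have h: "hyp Xvec $ k \<in> P" for k by blast
  have two: "2 \<notin> P" using cst[OF assms] by simp
  have "2 * Xv 1 = hyp Xvec $ 2 + hyp Xvec $ 1" "2 * Xv 2 = hyp Xvec $ 2 - hyp Xvec $ 1"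
    "2 * Xv 3 = hyp Xvec $ 4 + hyp Xvec $ 3" "2 * Xv 4 = hyp Xvec $ 4 - hyp Xvec $ 3"
    by (simp_all add: hyp_def)
  then have "2 * Xv 1 \<in> P" "2 * Xv 2 \<in> P" "2 * Xv 3 \<in> P" "2 * Xv 4 \<in> P"
    using h add diff by metis+
  then have "\<forall>i. Xv i \<in> P" using two by (simp add: mult_iff forall_4)
  then show False using ex_Xv by blast
qed

lemma scheme_endo_tau: "scheme_endo (R_ideal :: 'k::{field, field_char_0} coord_ring set) tau_charts"
proof -
  have "P \<in> (\<Union>k. chart_domain k)" if "P \<in> zeros R_ideal" for P :: "'k coord_ring set"
  proof -
    interpret proj_point P using that by (simp add: zeros_def proj_point_def)
    obtain k where "hyp Xvec $ k \<notin> P" using ex_hyp by auto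
    then show ?thesis using that by (auto simp: zeros_def)
  qed
  then have "(\<Union>k. chart_domain k) = zeros (R_ideal :: 'k coord_ring set)" by auto
  then have "(\<Union>c\<in>tau_charts. fst c) = zeros (R_ideal :: 'k coord_ring set)"
    by (simp add: tau_charts_def)
  moreover have "\<forall>c\<in>tau_charts. is_chart (R_ideal :: 'k coord_ring set) c"
    unfolding tau_charts_def by clarify (rule is_chart_tau)
  moreover have "\<forall>(U, f)\<in>tau_charts. \<forall>(W, g)\<in>tau_charts. \<forall>P\<in>U \<inter> W. \<forall>i j.
      germ_zero (R_ideal :: 'k coord_ring set) P (f $ i * g $ j - f $ j * g $ i)"
    unfolding tau_charts_def
    by (clarify, rule germ_zero_charts; rule chart_domainD, rule DiffI; assumption)
  ultimately show ?thesis unfolding scheme_endo_def by blast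
qed

lemma comp_is_id_tau: "comp_is_id (R_ideal :: 'k::{field, field_char_0} coord_ring set) tau_charts tau_charts"
proof -
  have *: "germ_zero R_ideal P (poly_subst (chart Xvec $ l $ i) (chart Xvec $ k) * Xv j -
      poly_subst (chart Xvec $ l $ j) (chart Xvec $ k) * Xv i)"
    if P: "P \<in> chart_domain k" and im: "image_point (chart Xvec $ k) P \<in> chart_domain l"
    for k l i j and P :: "'k coord_ring set"
  proof -
    interpret proj_point P by (rule chart_domainD[OF P])
    \<comment> \<open>The condition on the image point becomes one on \<open>P\<close>:
      \<open>image_point\<close> tests homogeneous components, and a linear form has only the one in
      degree 1, the others being zero.\<close>
    have "hyp Xvec $ l \<notin> image_point (chart Xvec $ k) P" by (rule chart_domainD[OF im])
    then obtain d where "poly_subst (hcomp d (hyp Xvec $ l)) (chart Xvec $ k) \<notin> P"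
      by (auto simp: image_point_def)
    then have "poly_subst (hyp Xvec $ l) (chart Xvec $ k) \<notin> P"
      using zero by (auto simp: hcomp_homogeneous[OF homogeneous_hyp] rhom.zero[OF rhom_poly_subst] split: if_splits)
    then have "hyp (chart Xvec $ k) $ l \<notin> P"
      by (simp add: rhom_hyp[OF rhom_poly_subst])
    then show ?thesis
      using germ_zero_chart_chart[OF proj_point_axioms chart_domainD(2)[OF P]]
      by (simp add: rhom_chart[OF rhom_poly_subst])
  qed
  show ?thesis
    unfolding comp_is_id_def tau_charts_def by (clarify, rule *; rule DiffI; assumption)
qed

lemma tau_eq_chart:
  fixes v :: "'k::{field, field_char_0} ^ 4"
  assumes L: "L \<in> kpoints (chart_domain k)" and v: "v \<in> L" "v \<noteq> 0"
  shows "tau relations_R L = vec.span {\<chi> i. poly_at (chart Xvec $ k $ i) v}"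
proof -
  have "L \<in> kpoints (zeros R_ideal)" using L by (auto simp: kpoints_def)
  from pt_if_in_kpoints[OF this v] obtain e a b
    where e: "v = pt e a b" "(a, b) \<noteq> (0, 0)" "L = vec.span {v}" .
  have "hyp Xvec $ k \<notin> {f. \<forall>x\<in>L. poly_at f x = 0}"
    using L by (intro chart_domainD) (auto simp: kpoints_def)
  then have "poly_at (hyp Xvec $ k) v \<noteq> 0"
    unfolding e(3) vanishing_ideal_span mem_point_ideal_if_homogeneous[OF homogeneous_hyp] .
  then have "hyp v $ k \<noteq> 0" by (simp add: rhom_hyp[OF rhom_poly_at])
  then obtain c where c: "c * c = 1" "chart v $ k = c *s pt (opp e) a (sg e b)"
    using chart_pt unfolding e(1) by blast
  then have "vec.span {chart v $ k} = vec.span {pt (opp e) a (sg e b)}"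
    by (metis mult_zero_left span_singleton_scale zero_neq_one)
  also have "\<dots> = tau relations_R L" using tau_pt[OF e(2)] e by simp
  finally show ?thesis by (simp add: rhom_chart[OF rhom_poly_at])
qed

lemma scheme_automorphism_tau:
  "scheme_automorphism (R_ideal :: 'k::{field, field_char_0} coord_ring set) (tau relations_R)"
  unfolding scheme_automorphism_def
proof (intro exI conjI)
  show "\<forall>(U, f)\<in>tau_charts. \<forall>L\<in>kpoints U. \<forall>v\<in>L. v \<noteq> 0 \<longrightarrow>
      tau relations_R L = vec.span {(\<chi> i. poly_at (f $ i) v) :: 'k ^ 4}"
    unfolding tau_charts_def by (clarify, rule tau_eq_chart)
qed (rule scheme_endo_tau comp_is_id_tau)+

section \<open>Dimension\<close>

text \<open>Binary forms of degree \<open>N\<close> in \<open>a\<close> and \<open>b\<close>, with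
  only the coefficients up to \<open>N\<close> mattering. With the two parameters of a line for
  \<open>a\<close> and \<open>b\<close>, they are what homogeneous polynomials restrict to.\<close>

definition bform :: "(nat \<Rightarrow> 'k::field) \<Rightarrow> 'k coord_ring \<Rightarrow> 'k coord_ring \<Rightarrow> nat \<Rightarrow> 'k coord_ring"
  where "bform c a b N = (\<Sum>i\<le>N. cst (c i) * a ^ i * b ^ (N - i))"

definition bforms :: "'k::field coord_ring \<Rightarrow> 'k coord_ring \<Rightarrow> nat \<Rightarrow> 'k coord_ring set"
  where "bforms a b N = range (\<lambda>c. bform c a b N)"

lemma bforms_0: "0 \<in> bforms a b N"
  unfolding bforms_def by (rule range_eqI[of _ _ "\<lambda>_. 0"]) (simp add: bform_def)

lemma bforms_add: "x \<in> bforms a b N \<Longrightarrow> y \<in> bforms a b N \<Longrightarrow> x + y \<in> bforms a b N"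
  unfolding bforms_def
proof (elim rangeE)
  fix c d assume "x = bform c a b N" "y = bform d a b N"
  then have "x + y = bform (\<lambda>i. c i + d i) a b N"
    by (simp add: bform_def single_add distrib_right sum.distrib)
  then show "x + y \<in> range (\<lambda>c. bform c a b N)" by simp
qed

lemma bforms_cst_mult: "x \<in> bforms a b N \<Longrightarrow> cst r * x \<in> bforms a b N"
  unfolding bforms_def
proof (elim rangeE)
  fix c assume "x = bform c a b N"
  then have "cst r * x = bform (\<lambda>i. r * c i) a b N"
    by (simp add: bform_def sum_distrib_left mult.assoc[symmetric] mult_single)
  then show "cst r * x \<in> range (\<lambda>c. bform c a b N)" by simp
qed

lemma a_mult_bform: "a * bform c a b N = bform (\<lambda>i. case i of 0 \<Rightarrow> 0 | Suc j \<Rightarrow> c j) a b (Suc N)"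
  by (simp add: bform_def sum.atMost_Suc_shift sum_distrib_left mult_ac del: sum.atMost_Suc)

lemma b_mult_bform: "b * bform c a b N = bform (\<lambda>i. if i \<le> N then c i else 0) a b (Suc N)"
proof -
  have "bform (\<lambda>i. if i \<le> N then c i else 0) a b (Suc N) = (\<Sum>i\<le>N. cst (c i) * a ^ i * b ^ (Suc N - i))"
    by (simp add: bform_def)
  also have "\<dots> = (\<Sum>i\<le>N. b * (cst (c i) * a ^ i * b ^ (N - i)))"
    by (rule sum.cong) (simp_all add: Suc_diff_le mult_ac)
  finally show ?thesis by (simp add: bform_def sum_distrib_left)
qed

lemma pt_mult_bforms:
  assumes "x \<in> bforms a b N"
  shows "pt e a b $ i * x \<in> bforms a b (Suc N)"
proof -
  have ab: "a * x \<in> bforms a b (Suc N)" "b * x \<in> bforms a b (Suc N)"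
    using assms by (auto simp: bforms_def a_mult_bform b_mult_bform)
  have "- (a * x) \<in> bforms a b (Suc N)" "- (b * x) \<in> bforms a b (Suc N)"
    using bforms_cst_mult[OF ab(1), of "- 1"] bforms_cst_mult[OF ab(2), of "- 1"]
    by (simp_all add: single_uminus)
  with ab show ?thesis
    by - (rule all_4[of _ i]; cases e; simp add: bforms_0)
qed

lemma eval_mon_pt_in_bforms: "eval_mon (pt e a b) m \<in> bforms a b (mdegree m)"
proof -
  have pow: "pt e a b $ i ^ n * x \<in> bforms a b (n + N)" if "x \<in> bforms a b N" for i n N x
    by (induction n) (auto simp: that mult.assoc intro: pt_mult_bforms)
  have "1 \<in> bforms a b 0"
    unfolding bforms_def by (rule range_eqI[of _ _ "\<lambda>_. 1"]) (simp add: bform_def)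
  then have "(\<Prod>i\<in>S. pt e a b $ i ^ Poly_Mapping.lookup m i) \<in> bforms a b (\<Sum>i\<in>S. Poly_Mapping.lookup m i)" for S
    by (induction S rule: infinite_finite_induct) (auto intro: pow)
  then show ?thesis by (simp add: eval_mon_def mdegree_def)
qed

lemma poly_subst_pt_in_bforms:
  assumes "homogeneous N f"
  shows "poly_subst f (pt e a b) \<in> bforms a b N"
proof -
  have "sum g S \<in> bforms a b N" if "\<And>m. m \<in> S \<Longrightarrow> g m \<in> bforms a b N" for g and S :: "(4 \<Rightarrow>\<^sub>0 nat) set"
    using that by (induction S rule: infinite_finite_induct) (simp_all add: bforms_0 bforms_add)
  moreover have "cst (Poly_Mapping.lookup f m) * eval_mon (pt e a b) m \<in> bforms a b N"
    if "m \<in> Poly_Mapping.keys f" for m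
    using that assms eval_mon_pt_in_bforms[of e a b m] by (simp add: homogeneous_def bforms_cst_mult)
  ultimately show ?thesis by (simp add: poly_subst_eq_ev ev_def)
qed

text \<open>Synthetic division of the dehomogenized form by \<open>t - r\<close>.\<close>

lemma bform_root:
  assumes root: "(\<Sum>k\<le>Suc N. c k * r ^ k) = 0"
  shows "\<exists>d. d N = c (Suc N) \<and> bform c a b (Suc N) = (a - cst r * b) * bform d a b N"
proof -
  \<comment> \<open>The quotient coefficients of Horner's scheme; \<open>rec\<close> is its
    recursion, read from the leading coefficient downwards.\<close>
  define d where "d j = (\<Sum>k\<le>N - j. c (Suc (j + k)) * r ^ k)" for j
  have rec: "d j = c (Suc j) + r * d (Suc j)" if "j < N" for j
  proof -
    have "N - j = Suc (N - Suc j)" using that by simp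
    then have "d j = c (Suc j) + (\<Sum>k\<le>N - Suc j. c (Suc (j + Suc k)) * r ^ Suc k)"
      unfolding d_def by (simp only: sum.atMost_Suc_shift) simp
    then show ?thesis by (simp add: d_def sum_distrib_left mult_ac)
  qed
  \<comment> \<open>The remainder of the division is the value at \<open>r\<close>, so this is where
    the root is used.\<close>
  have c0: "c 0 = - (r * d 0)"
    using root by (simp add: d_def sum.atMost_Suc_shift sum_distrib_left mult_ac add_eq_0_iff2 del: sum.atMost_Suc)
  have dN: "d N = c (Suc N)" by (simp add: d_def)
  \<comment> \<open>Coefficient comparison c_i = d_(i-1) - r d_i, with d extended by zero below 0
    and above \<open>N\<close>.\<close>
  have c: "c i = (case i of 0 \<Rightarrow> 0 | Suc j \<Rightarrow> d j) - r * (if i \<le> N then d i else 0)" if "i \<le> Suc N" for i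
  proof (cases i)
    case 0
    then show ?thesis using c0 by simp
  next
    case (Suc j)
    show ?thesis
    proof (cases "j < N")
      case True
      then show ?thesis using rec[OF True] Suc by simp
    next
      case False
      then have "j = N" using that Suc by simp
      then show ?thesis using dN Suc by simp
    qed
  qed
  have "(a - cst r * b) * bform d a b N = a * bform d a b N - cst r * (b * bform d a b N)"
    by (simp add: algebra_simps)
  also have "\<dots> = (\<Sum>i\<le>Suc N. (cst (case i of 0 \<Rightarrow> 0 | Suc j \<Rightarrow> d j) -
      cst r * cst (if i \<le> N then d i else 0)) * a ^ i * b ^ (Suc N - i))"
    unfolding a_mult_bform b_mult_bform unfolding bform_def
    by (simp only: sum_distrib_left sum_subtractf left_diff_distrib mult.assoc)
  also have "\<dots> = bform c a b (Suc N)"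
    unfolding bform_def
    by (rule sum.cong) (simp_all add: c mult_single single_diff)
  finally show ?thesis using dN by metis
qed

text \<open>A nonzero binary form over a field with roots splits into linear factors, one of which
  lies in the prime \<open>P\<close>. Factors are removed one at a time by induction on the
  degree.\<close>

lemma (in proj_point) linear_factor_mem:
  fixes c :: "nat \<Rightarrow> 'k" and a b :: "'k coord_ring"
  assumes closed: "\<And>n f. n > 0 \<Longrightarrow> f n \<noteq> (0 :: 'k) \<Longrightarrow> \<exists>x. (\<Sum>k\<le>n. f k * x ^ k) = 0"
    and "bform c a b N \<in> P" "i \<le> N" "c i \<noteq> 0"
  shows "b \<in> P \<or> (\<exists>r. a - cst r * b \<in> P)"
  using assms(2-)
proof (induction N arbitrary: c i)
  case 0
  then show ?case using cst by (simp add: bform_def)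
next
  case (Suc N)
  show ?case
  proof (cases "c (Suc N) = 0")
    case True
    \<comment> \<open>A zero top coefficient is a root at infinity, which means that
      \<open>b\<close> divides the form.\<close>
    then have "bform c a b (Suc N) = bform (\<lambda>i. if i \<le> N then c i else 0) a b (Suc N)"
      unfolding bform_def by (intro sum.cong) (auto simp: le_Suc_eq)
    then have "b * bform c a b N \<in> P" using Suc.prems by (simp add: b_mult_bform)
    moreover have "i \<le> N" using Suc.prems True by (metis le_Suc_eq)
    ultimately show ?thesis using Suc.IH[of c i] Suc.prems(3) by (auto simp: mult_iff)
  next
    case False
    then obtain r where "(\<Sum>k\<le>Suc N. c k * r ^ k) = 0" using closed[of "Suc N" c] by blast
    then obtain d where "d N = c (Suc N)" "bform c a b (Suc N) = (a - cst r * b) * bform d a b N"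
      using bform_root by blast
    then show ?thesis using Suc.IH[of d N] Suc.prems False by (auto simp: mult_iff)
  qed
qed

text \<open>Restricted to the line, a homogeneous element of \<open>P\<close> outside the line ideal
  is a nonzero binary form. Since \<open>P\<close> contains one of its linear factors, both
  parameters, and with them all variables, are modulo \<open>P\<close> scalar multiples of one
  element \<open>l\<close>.\<close>

lemma point_ideal_above_line_ideal:
  fixes P :: "'k::{alg_closed_field, field_char_0} coord_ring set"
  assumes P: "P \<in> Proj" "line_ideal e \<subset> P"
  shows "\<exists>v l. \<forall>i. Xv i - cst (v $ i) * l \<in> P"
proof -
  interpret proj_point P using P by (simp add: proj_point_def)
  interpret Q: proj_point "line_ideal e :: 'k coord_ring set" by (rule proj_point_line_ideal)
  let ?a = "coord1 e Xvec :: 'k coord_ring" and ?b = "coord2 e Xvec :: 'k coord_ring"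
  have lpt: "Xv i - lpt e $ i \<in> P" for i
    using P(2) eqs_subset_line_ideal by (intro Xv_cong_lpt) blast
  obtain f where "f \<in> P" "f \<notin> line_ideal e" using P(2) by blast
  \<comment> \<open>The line ideal contains any polynomial whose components it contains, so some
    component of \<open>f\<close> is outside it, while \<open>P\<close> contains all
    components.\<close>
  then obtain N where N: "hcomp N f \<in> P" "hcomp N f \<notin> line_ideal e"
    using Q.mem_if_hcomp hcomp by blast
  obtain c where c: "poly_subst (hcomp N f) (lpt e) = bform c ?a ?b N"
    using poly_subst_pt_in_bforms[OF homogeneous_hcomp] unfolding bforms_def by blast
  have "poly_subst (hcomp N f) Xvec - poly_subst (hcomp N f) (lpt e) \<in> P"
    by (rule cong_poly_subst) (simp add: lpt)
  then have "bform c ?a ?b N \<in> P" using cong_mem N(1) by (simp add: c)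
  moreover have nz: "bform c ?a ?b N \<noteq> 0" using N(2) by (simp add: line_ideal_def c)
  obtain i where "i \<le> N" "c i \<noteq> 0"
  proof (rule ccontr)
    assume "\<not> thesis"
    then have "\<And>i. i \<le> N \<Longrightarrow> c i = 0" using that by blast
    then show False using nz by (simp add: bform_def)
  qed
  ultimately have "?b \<in> P \<or> (\<exists>r. ?a - cst r * ?b \<in> P)"
    by (intro linear_factor_mem[of c _ _ N i] alg_closed)
  then show ?thesis
  proof (elim disjE exE)
    assume b: "?b \<in> P"
    \<comment> \<open>The second parameter vanishes: the point with parameters (1, 0), and
      \<open>l\<close> is the first parameter.\<close>
    have h: "lpt e $ i - cst (pt e 1 0 $ i) * ?a \<in> P" for i
      by (rule all_4[of _ i]; insert b; cases e; simp add: zero uminus single_uminus)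
    then have "Xv i - cst (pt e 1 0 $ i) * ?a \<in> P" for i
      using add[OF lpt[of i] h[of i]] by simp
    then show ?thesis by blast
  next
    fix r assume r: "?a - cst r * ?b \<in> P"
    have r': "cst r * ?b - ?a \<in> P" using uminus[OF r] by simp
    \<comment> \<open>The parameters have ratio r : 1, and \<open>l\<close> is the second
      one.\<close>
    have h: "lpt e $ i - cst (pt e r 1 $ i) * ?b \<in> P" for i
      by (rule all_4[of _ i]; insert r r'; cases e; simp add: zero uminus single_uminus)
    then have "Xv i - cst (pt e r 1 $ i) * ?b \<in> P" for i
      using add[OF lpt[of i] h[of i]] by simp
    then show ?thesis by blast
  qed
qed

text \<open>The chain of length one is completed by the point with parameters (1, 0), at which the
  second parameter vanishes though it does not vanish on the whole line.\<close>

lemma krull_dim_line: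
  "krull_dim (scheme_space (line_ideal e :: 'k::{alg_closed_field, field_char_0} coord_ring set)) = 1"
proof (rule krull_dim_scheme_space_eq_1[of "line_ideal e" _ "point_ideal (pt e 1 0)"])
  let ?v = "pt e 1 0 :: 'k ^ 4"
  have v: "?v \<noteq> 0" by (simp only: pt_eq_0_iff) simp
  show "point_ideal ?v \<in> Proj" by (rule point_ideal_in_Proj[OF v])
  have "line_ideal e \<subseteq> point_ideal ?v"
    using point_ideal_in_line_iff[OF v] by (auto simp: zeros_def)
  moreover have "coord2 e Xvec \<in> point_ideal ?v"
    by (subst mem_point_ideal_if_homogeneous[of 1]) (cases e; simp add: homogeneous_Xv[simplified])+
  moreover have "coord2 e Xvec \<notin> (line_ideal e :: 'k coord_ring set)"
    using poly_at_pt_eq_0[of "coord2 e Xvec" e 0 "1 :: 'k"] by (cases e) auto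
  ultimately show "line_ideal e \<subset> point_ideal ?v" by blast
  fix P P' :: "'k coord_ring set"
  assume P: "P \<in> Proj" "P' \<in> Proj" "line_ideal e \<subset> P" "P \<subseteq> P'"
  obtain v l where vl: "\<And>i. Xv i - cst (v $ i) * l \<in> P"
    using point_ideal_above_line_ideal[OF P(1,3)] by blast
  \<comment> \<open>The congruences for \<open>P\<close> hold a fortiori in \<open>P'\<close>, so
    both primes equal the same point ideal.\<close>
  have "P = point_ideal v" by (rule proj_point.eq_point_ideal[OF _ vl]) (simp add: proj_point_def P)
  moreover have "P' = point_ideal v"
    by (rule proj_point.eq_point_ideal) (use vl P in \<open>auto simp: proj_point_def\<close>)
  ultimately show "P' = P" by simp
qed (auto simp: line_ideal_in_Proj zeros_def)

section \<open>The point scheme\<close>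

lemma irreducible_components_R_ideal:
  "irreducible_components (scheme_space (R_ideal :: 'k::{field, field_char_0} coord_ring set)) =
    range (\<lambda>e. zeros (line_ideal e))"
  by (rule irreducible_components_scheme_space[OF zeros_R_ideal line_ideal_in_Proj line_ideal_incomparable])

lemma inj_zeros_line_ideal:
  "inj (\<lambda>e. zeros (line_ideal e :: 'k::{field, field_char_0} coord_ring set))"
proof
  fix e e' assume "zeros (line_ideal e :: 'k coord_ring set) = zeros (line_ideal e')"
  then have "(line_ideal e' :: 'k coord_ring set) \<in> zeros (line_ideal e)"
    by (simp add: zeros_def line_ideal_in_Proj)
  then have "line_ideal e \<subseteq> (line_ideal e' :: 'k coord_ring set)" by (simp add: zeros_def)
  then show "e = e'" by (rule line_ideal_incomparable)
qed

lemma equidimensional_R_ideal: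
  "equidimensional (scheme_space (R_ideal :: 'k::{alg_closed_field, field_char_0} coord_ring set)) 1"
proof -
  have "zeros (line_ideal e) \<subseteq> zeros (R_ideal :: 'k coord_ring set)" for e
    unfolding zeros_R_ideal by blast
  then show ?thesis
    unfolding equidimensional_def irreducible_components_R_ideal
    by (auto simp: scheme_space_subset krull_dim_line)
qed

lemma E_eq_zeros_line_ideal:
  "E12 = zeros (line_ideal L12)" "E34 = zeros (line_ideal L34)" "E13 = zeros (line_ideal L13)"
  "E24 = zeros (line_ideal L24)" "E23 = zeros (line_ideal L23)" "E14 = zeros (line_ideal L14)"
  unfolding zeros_eqs[symmetric] by (simp_all add: E12_def E34_def E13_def E24_def E23_def E14_def)

text \<open>For \<open>E12\<close> and \<open>E34\<close>, which are given by variables instead of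
  plane forms; 2 is a unit and so lies outside every point.\<close>

lemma zeros_eq_plane_Int:
  fixes f g :: "'k::{field, field_char_0} coord_ring"
  shows "zeros {f, g} = zeros {f - g} \<inter> zeros {f + g}"
proof -
  have "f \<in> P \<and> g \<in> P \<longleftrightarrow> f - g \<in> P \<and> f + g \<in> P" if "P \<in> Proj" for P
  proof -
    interpret proj_point P using that by (simp add: proj_point_def)
    have two: "2 \<notin> P" using cst[of 2] by simp
    have "2 * f = (f - g) + (f + g)" "2 * g = (f + g) - (f - g)" by simp_all
    then have "2 * f \<in> P" "2 * g \<in> P" if "f - g \<in> P" "f + g \<in> P"
      using add[OF that] diff[OF that(2,1)] by (simp_all only:)
    then show ?thesis using two add[of f g] diff[of f g] by (auto simp: mult_iff)
  qed
  then show ?thesis by (auto simp: zeros_def)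
qed

lemma zeros_pair: "zeros {f, g} = zeros {f} \<inter> zeros {g}"
  by (auto simp: zeros_def)

lemma plane_eq_zeros:
  "plane 1 = zeros {Xv 1 - Xv 2}" "plane 2 = zeros {Xv 1 + Xv 2}"
  "plane 3 = zeros {Xv 3 - Xv 4}" "plane 4 = zeros {Xv 3 + Xv 4}"
  by (simp_all add: plane_def)

lemma E_eq_plane_Int:
  shows "E12 = (plane 1 \<inter> plane 2 :: 'k::{field, field_char_0} coord_ring set set)"
    and "E34 = (plane 3 \<inter> plane 4 :: 'k coord_ring set set)"
    and "E13 = plane 1 \<inter> plane 3" "E24 = plane 2 \<inter> plane 4"
    and "E23 = plane 2 \<inter> plane 3" "E14 = plane 1 \<inter> plane 4"
  unfolding E12_def E34_def E13_def E24_def E23_def E14_def plane_eq_zeros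
  by (rule zeros_eq_plane_Int zeros_pair)+

theorem theorem4p2p2:
  fixes rel :: "'k::{alg_closed_field, field_char_0} free_algebra ^ 6"
    and I :: "'k coord_ring set"
    and \<tau> :: "('k ^ 4) set \<Rightarrow> ('k ^ 4) set"
  assumes rel: "rel = relations_R"
    and I: "I = point_scheme_ideal rel"
    and \<tau>: "\<tau> = tau rel"
  shows
    "irreducible_components (scheme_space I) = {E12, E34, E13, E24, E23, E14}
     \<and> card (irreducible_components (scheme_space I)) = 6
     \<and> E12 = (plane 1 \<inter> plane 2 :: 'k coord_ring set set)
     \<and> E34 = (plane 3 \<inter> plane 4 :: 'k coord_ring set set)
     \<and> E13 = (plane 1 \<inter> plane 3 :: 'k coord_ring set set)
     \<and> E24 = (plane 2 \<inter> plane 4 :: 'k coord_ring set set)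
     \<and> E23 = (plane 2 \<inter> plane 3 :: 'k coord_ring set set)
     \<and> E14 = (plane 1 \<inter> plane 4 :: 'k coord_ring set set)
     \<and> (\<forall>L\<in>kpoints (zeros I). \<forall>v\<in>L. v \<noteq> 0 \<longrightarrow> rank (matrix_at rel v) = 3)
     \<and> scheme_automorphism I \<tau>
     \<and> \<tau> ` kpoints E12 = kpoints E12
     \<and> (\<forall>a b. (a, b) \<noteq> (0, 0) \<longrightarrow> \<tau> (hpoint 0 0 a b) = hpoint 0 0 a (- b))
     \<and> \<tau> ` kpoints E34 = kpoints E34
     \<and> (\<forall>a b. (a, b) \<noteq> (0, 0) \<longrightarrow> \<tau> (hpoint a b 0 0) = hpoint a (- b) 0 0)
     \<and> \<tau> ` kpoints E13 = kpoints E24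
     \<and> (\<forall>a b. (a, b) \<noteq> (0, 0) \<longrightarrow> \<tau> (hpoint a a b b) = hpoint a (- a) b (- b))
     \<and> \<tau> ` kpoints E24 = kpoints E13
     \<and> (\<forall>a b. (a, b) \<noteq> (0, 0) \<longrightarrow> \<tau> (hpoint a (- a) b (- b)) = hpoint a a b b)
     \<and> \<tau> ` kpoints E23 = kpoints E14
     \<and> (\<forall>a b. (a, b) \<noteq> (0, 0) \<longrightarrow> \<tau> (hpoint a (- a) b b) = hpoint a a (- b) b)
     \<and> \<tau> ` kpoints E14 = kpoints E23
     \<and> (\<forall>a b. (a, b) \<noteq> (0, 0) \<longrightarrow> \<tau> (hpoint a a b (- b)) = hpoint a (- a) (- b) (- b))
     \<and> equidimensional (scheme_space I) 1
     \<and> reduced_scheme I"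
proof -
  let ?R = "R_ideal :: 'k coord_ring set"
  have R: "I = ?R" "\<tau> = tau relations_R" using rel I \<tau> by simp_all
  have comps: "irreducible_components (scheme_space I) = {E12, E34, E13, E24, E23, E14}"
    unfolding R irreducible_components_R_ideal UNIV_line by (simp add: E_eq_zeros_line_ideal)
  have "card (irreducible_components (scheme_space I)) = card (UNIV :: line set)"
    unfolding R irreducible_components_R_ideal by (rule card_image[OF inj_zeros_line_ideal])
  then have card: "card (irreducible_components (scheme_space I)) = 6"
    by (simp add: UNIV_line)
  have rank: "rank (matrix_at rel v) = 3" if "L \<in> kpoints (zeros I)" "v \<in> L" "v \<noteq> 0" for L v
    using that unfolding R rel matrix_at_relations_R by (metis pt_if_in_kpoints rank_rel_mat_pt)
  have image: "\<tau> ` kpoints E12 = kpoints E12" "\<tau> ` kpoints E34 = kpoints E34"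
    "\<tau> ` kpoints E13 = kpoints E24" "\<tau> ` kpoints E24 = kpoints E13"
    "\<tau> ` kpoints E23 = kpoints E14" "\<tau> ` kpoints E14 = kpoints E23"
    unfolding R E_eq_zeros_line_ideal tau_image_kpoints by simp_all
  have tau: "\<tau> (vec.span {pt e a b}) = vec.span {pt (opp e) a (sg e b)}" if "(a, b) \<noteq> (0, 0)" for e a b
    unfolding R using that by (rule tau_pt)
  have map: "\<tau> (hpoint 0 0 a b) = hpoint 0 0 a (- b)" "\<tau> (hpoint a b 0 0) = hpoint a (- b) 0 0"
    "\<tau> (hpoint a a b b) = hpoint a (- a) b (- b)" "\<tau> (hpoint a (- a) b (- b)) = hpoint a a b b"
    "\<tau> (hpoint a (- a) b b) = hpoint a a (- b) b" "\<tau> (hpoint a a b (- b)) = hpoint a (- a) (- b) (- b)"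
    if "(a, b) \<noteq> (0, 0)" for a b
    using tau[OF that, of L12] tau[OF that, of L34] tau[OF that, of L13]
      tau[OF that, of L24] tau[OF that, of L23] tau[OF that, of L14]
    by (simp_all add: hpoint_def)
  have rank': "\<forall>L\<in>kpoints (zeros I). \<forall>v\<in>L. v \<noteq> 0 \<longrightarrow> rank (matrix_at rel v) = 3"
    using rank by blast
  have global: "scheme_automorphism I \<tau>" "equidimensional (scheme_space I) 1" "reduced_scheme I"
    unfolding R by (rule scheme_automorphism_tau equidimensional_R_ideal reduced_R_ideal)+
  show ?thesis
    by (intro conjI allI impI; (rule comps card E_eq_plane_Int rank' global image | erule map))
qed

end
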